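(* Let $E$ be a Polish space with Borel $\sigma$-algebra $\mathscr{E}$, let $\psi:E\to[1,\infty)$ be continuous, let $\mathbb{P}$ be a probability measure on $\Omega=E^{\mathbb{N}}$ with coordinate projections $\xi=(\xi_1,\xi_2,\dots)$, empirical measures $m_n=\frac1n\sum_{i=1}^n\delta_{\xi_i}$ and canonical random measure $\upsilon$ (a regular version of $\mathbb{P}[\xi_1\in\cdot\,\vert\,\mathscr{I}]$ given the shift-invariant $\sigma$-algebra $\mathscr{I}$). Let $T$ be a Polish space with a metric $d_T$ inducing its topology, and let $\theta:E\to E$ be $(\mathscr{E},\mathscr{E})$-measurable. Assume that $\xi$ is stationary, that $\mathscr{L}(\xi_1)\in\mathfrak{M}_1^\psi(E)$ and that $\mathscr{L}(\theta(\xi_1))\in\mathfrak{M}_1^\psi(E)$. If $\tau:\mathfrak{M}_1^\psi(E)\to T$ is uniformly $\psi$-continuous and admits $\kappa$ as modulus of continuity, then $$\limsup_{n\ge1}\ \pi\big(\mathbb{P}\circ\tau(m_n)^{-1},\ \mathbb{P}\circ\tau(m_n\circ\theta^{-1})^{-1}\big)\le\kappa\big(\Vert\theta\Vert_{\mathbb{P},\kappa}\big),$$ where $\Vert\theta\Vert_{\mathbb{P},\kappa}:=\inf\{\alpha>0:\ \mathbb{P}\{d_\psi(\upsilon,\upsilon\circ\theta^{-1})>\alpha\}\le\kappa(\alpha)\}$.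
   Context: $\mathfrak{M}_1(E)$ is the set of Borel probability measures on $E$, $\mu f:=\int_E f\,d\mu$, and $\mathfrak{M}_1^\psi(E):=\{\mu\in\mathfrak{M}_1(E):\mu\psi<+\infty\}$. For a separable metric space $(S,d)$ and Borel probability measures $\mu,\nu$ on $S$, the Prohorov distance is $\pi(\mu,\nu):=\inf\{\varepsilon>0:\mu(B)\le\nu(B^\varepsilon)+\varepsilon\text{ for all Borel }B\}$, $B^\varepsilon:=\{x:\inf_{y\in B}d(y,x)<\varepsilon\}$. Fix a metric $d$ on $E$ inducing its topology. On $\mathfrak{M}_1^\psi(E)$ put $d_\psi(\mu,\nu):=\pi(\mu,\nu)+|(\mu-\nu)\psi|$, with $\pi$ the Prohorov distance on $\mathfrak{M}_1(E)$ relative to $d$; $d_\psi$ metrizes the $\psi$-weak topology (the coarsest topology on $\mathfrak{M}_1^\psi(E)$ making $\mu\mapsto\mu f$ continuous for all continuous $f$ with $\|f/\psi\|_\infty<\infty$). In the claim, $\pi$ is the Prohorov distance between Borel probability measures on $T$, relative to $d_T$. $\tau$ is uniformly $\psi$-continuous if for every $\varepsilon>0$ there is $\delta>0$ with $d_T(\tau(\mu_1),\tau(\mu_2))<\varepsilon$ whenever $d_\psi(\mu_1,\mu_2)<\delta$. $\kappa$ is a modulus of continuity of $\tau$ if $\kappa:[0,+\infty]\to[0,+\infty]$ is continuous and strictly increasing and $d_T(\tau(\mu_1),\tau(\mu_2))\le\kappa(d_\psi(\mu_1,\mu_2))$ for all $\mu_1,\mu_2\in\mathfrak{M}_1^\psi(E)$.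 $\Omega=E^{\mathbb{N}}$, $\xi_n(\omega)=\omega_n$, $\mathscr{F}$ is the product $\sigma$-algebra $\mathscr{E}^{\mathbb{N}}$, and $(\Omega,\mathscr{F},\mathbb{P})$ is taken to be complete (completed with respect to $\mathbb{P}$). $\mathscr{L}(\cdot)$ denotes the law under $\mathbb{P}$. $\Sigma(x_1,x_2,\dots)=(x_2,x_3,\dots)$; $\xi$ is stationary if $\xi$ and $\Sigma\xi$ have the same law on $E^{\mathbb{N}}$. $\mathscr{I}=\{I\in\mathscr{E}^{\mathbb{N}}:\Sigma^{-1}(I)=I\}$. $\upsilon$ is an $\mathscr{I}$-measurable probability kernel $(\omega,B)\mapsto\upsilon(\omega,B)$ that is a regular version of $\mathbb{P}[\xi_1\in\cdot\,\vert\,\mathscr{I}]$. For a random measure $\chi$, $(\chi\circ\theta^{-1})(\omega,B):=\chi(\omega,\theta^{-1}(B))$; in particular $m_n\circ\theta^{-1}=\frac1n\sum_{i\le n}\delta_{\theta(\xi_i)}$. Under the hypotheses, $\upsilon$ and $\upsilon\circ\theta^{-1}$ lie in $\mathfrak{M}_1^\psi(E)$ $\mathbb{P}$-almost surely. $\mathbb{P}\circ X^{-1}$ denotes the law of a random element $X$. *)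

theory Defs
  imports "HOL-Probability.Probability"
begin

text \<open>The metric \<open>d\<close> on a space is \<open>dist\<close> of the class \<^class>\<open>metric_space\<close>; it need not be
  complete.\<close>

text \<open>The infimum is taken in the extended reals so that the enlargement of the empty set is
  empty (\<^const>\<open>infdist\<close> would give 0 there).\<close>

definition enlargement :: "'a::metric_space set \<Rightarrow> real \<Rightarrow> 'a set" where
  "enlargement B e = {x. (INF y\<in>B. ereal (dist y x)) < ereal e}"

definition prohorov :: "'a::metric_space measure \<Rightarrow> 'a measure \<Rightarrow> real" where
  "prohorov \<mu> \<nu> =
     Inf {e. 0 < e \<and> (\<forall>B\<in>sets borel. measure \<mu> B \<le> measure \<nu> (enlargement B e) + e)}"

definition M1psi :: "('a::topological_space \<Rightarrow> real) \<Rightarrow> 'a measure set" where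
  "M1psi \<psi> = {\<mu> \<in> space (prob_algebra borel). (\<integral>\<^sup>+x. ennreal (\<psi> x) \<partial>\<mu>) < \<infinity>}"

definition dpsi :: "('a::metric_space \<Rightarrow> real) \<Rightarrow> 'a measure \<Rightarrow> 'a measure \<Rightarrow> real" where
  "dpsi \<psi> \<mu> \<nu> = prohorov \<mu> \<nu> + \<bar>(\<integral>x. \<psi> x \<partial>\<mu>) - (\<integral>x. \<psi> x \<partial>\<nu>)\<bar>"

text \<open>Functionals on \<open>M1psi \<psi>\<close> are total functions on measures; only their values on
  \<open>M1psi \<psi>\<close> are constrained.\<close>

definition uniformly_psi_continuous ::
    "('a::metric_space \<Rightarrow> real) \<Rightarrow> ('a measure \<Rightarrow> 'b::metric_space) \<Rightarrow> bool" where
  "uniformly_psi_continuous \<psi> \<tau> \<longleftrightarrow>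
     (\<forall>e>0. \<exists>\<delta>>0. \<forall>\<mu>\<in>M1psi \<psi>. \<forall>\<nu>\<in>M1psi \<psi>. dpsi \<psi> \<mu> \<nu> < \<delta> \<longrightarrow> dist (\<tau> \<mu>) (\<tau> \<nu>) < e)"

definition modulus_of_continuity ::
    "('a::metric_space \<Rightarrow> real) \<Rightarrow> ('a measure \<Rightarrow> 'b::metric_space) \<Rightarrow> (ennreal \<Rightarrow> ennreal) \<Rightarrow> bool" where
  "modulus_of_continuity \<psi> \<tau> \<kappa> \<longleftrightarrow>
     continuous_on UNIV \<kappa> \<and> strict_mono \<kappa> \<and>
     (\<forall>\<mu>\<in>M1psi \<psi>. \<forall>\<nu>\<in>M1psi \<psi>. ennreal (dist (\<tau> \<mu>) (\<tau> \<nu>)) \<le> \<kappa> (ennreal (dpsi \<psi> \<mu> \<nu>)))"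

text \<open>Sequences are indexed from 0: the first coordinate \<open>\<xi>\<^sub>1\<close> is \<open>\<lambda>\<omega>. \<omega> 0\<close>, and the empirical
  measure of the first \<open>n\<close> coordinates runs over \<open>i < n\<close>.\<close>

definition seq_space :: "(nat \<Rightarrow> 'a::topological_space) measure" where
  "seq_space = (\<Pi>\<^sub>M i\<in>UNIV. borel)"

definition seq_shift :: "(nat \<Rightarrow> 'a) \<Rightarrow> nat \<Rightarrow> 'a" where
  "seq_shift \<omega> = (\<lambda>i. \<omega> (Suc i))"

definition stationary :: "(nat \<Rightarrow> 'a::topological_space) measure \<Rightarrow> bool" where
  "stationary P \<longleftrightarrow> distr P seq_space (\<lambda>\<omega>. \<omega>) = distr P seq_space seq_shift"

definition invariant_algebra :: "(nat \<Rightarrow> 'a::topological_space) measure" where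
  "invariant_algebra = sigma UNIV {A \<in> sets seq_space. seq_shift -` A = A}"

lemma space_seq_space [simp]: "space seq_space = UNIV"
  by (simp add: seq_space_def space_PiM)

lemma sets_invariant_algebra:
  "sets (invariant_algebra :: (nat \<Rightarrow> 'a::topological_space) measure) =
     {A \<in> sets seq_space. seq_shift -` A = A}"
proof -
  let ?I = "{A \<in> sets (seq_space :: (nat \<Rightarrow> 'a) measure). seq_shift -` A = A}"
  have "UNIV - A \<in> ?I" if "A \<in> ?I" for A
    using that sets.compl_sets[of A "seq_space :: (nat \<Rightarrow> 'a) measure"] by (simp add: vimage_Diff)
  moreover have "(\<Union>k. A k) \<in> ?I" if "range A \<subseteq> ?I" for A :: "nat \<Rightarrow> _"
  proof -
    have "A k \<in> sets seq_space" and "seq_shift -` A k = A k" for k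
      using that by auto
    then show ?thesis
      by (simp add: vimage_UN sets.countable_UN image_subset_iff)
  qed
  ultimately have "sigma_algebra UNIV ?I"
    unfolding sigma_algebra_iff2 by auto
  then show ?thesis
    unfolding invariant_algebra_def by (simp add: sigma_algebra.sigma_sets_eq)
qed

definition empirical :: "nat \<Rightarrow> (nat \<Rightarrow> 'a::topological_space) \<Rightarrow> 'a measure" where
  "empirical n \<omega> =
     measure_of UNIV (sets borel) (\<lambda>B. (\<Sum>i<n. emeasure (return borel (\<omega> i)) B) / of_nat n)"

lemma sets_empirical [simp]: "sets (empirical n \<omega>) = sets borel"
  using sets.sigma_sets_eq[of "borel :: 'a measure"] by (simp add: empirical_def)

lemma emeasure_empirical:
  assumes "B \<in> sets borel"
  shows "emeasure (empirical n \<omega>) B = (\<Sum>i<n. emeasure (return borel (\<omega> i)) B) / of_nat n"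
proof (rule emeasure_measure_of[OF empirical_def])
  show "countably_additive (sets (empirical n \<omega>))
          (\<lambda>B. (\<Sum>i<n. emeasure (return borel (\<omega> i)) B) / of_nat n)"
  proof (rule countably_additiveI)
    fix A :: "nat \<Rightarrow> 'a set"
    assume A: "range A \<subseteq> sets (empirical n \<omega>)" "disjoint_family A"
    have "(\<Sum>k. (\<Sum>i<n. emeasure (return borel (\<omega> i)) (A k)) / of_nat n)
            = (\<Sum>k. \<Sum>i<n. emeasure (return borel (\<omega> i)) (A k)) / of_nat n"
      by simp
    also have "(\<Sum>k. \<Sum>i<n. emeasure (return borel (\<omega> i)) (A k))
                 = (\<Sum>i<n. \<Sum>k. emeasure (return borel (\<omega> i)) (A k))"
      by (rule suminf_sum) simp
    also have "\<dots> = (\<Sum>i<n. emeasure (return borel (\<omega> i)) (\<Union>k. A k))"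
      using A by (intro sum.cong refl suminf_emeasure) auto
    finally show "(\<Sum>k. (\<Sum>i<n. emeasure (return borel (\<omega> i)) (A k)) / of_nat n)
        = (\<Sum>i<n. emeasure (return borel (\<omega> i)) (\<Union>k. A k)) / of_nat n" .
  qed
qed (use assms in \<open>auto simp: positive_def\<close>)

definition regular_conditional_law ::
    "'w measure \<Rightarrow> 'w measure \<Rightarrow> ('w \<Rightarrow> 'a::topological_space) \<Rightarrow> ('w \<Rightarrow> 'a measure) \<Rightarrow> bool" where
  "regular_conditional_law P F X \<upsilon> \<longleftrightarrow>
     \<upsilon> \<in> F \<rightarrow>\<^sub>M prob_algebra borel \<and>
     (\<forall>B\<in>sets borel. AE \<omega> in P.
        measure (\<upsilon> \<omega>) B = real_cond_exp P F (indicator (X -` B \<inter> space P)) \<omega>)"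

definition theta_norm ::
    "'w measure \<Rightarrow> (ennreal \<Rightarrow> ennreal) \<Rightarrow> ('a::metric_space \<Rightarrow> real) \<Rightarrow> ('w \<Rightarrow> 'a measure)
      \<Rightarrow> ('a \<Rightarrow> 'a) \<Rightarrow> ennreal" where
  "theta_norm P \<kappa> \<psi> \<upsilon> \<theta> =
     Inf (ennreal ` {\<alpha>. 0 < \<alpha> \<and>
       emeasure P {\<omega> \<in> space P. dpsi \<psi> (\<upsilon> \<omega>) (distr (\<upsilon> \<omega>) borel \<theta>) > \<alpha>} \<le> \<kappa> (ennreal \<alpha>)})"

end

theory Submission
  imports Defs
begin

text \<open>By the pointwise ergodic theorem, applied to \<open>\<psi>\<close>, \<open>\<psi> \<circ> \<theta>\<close> and to the indicators of the cells
  (and of their preimages under \<open>\<theta>\<close>) of countable partitions of arbitrarily small mesh, almost surely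
  \<open>m\<^sub>n \<longlonglongrightarrow> \<upsilon>\<close> and \<open>m\<^sub>n \<circ> \<theta>\<^sup>-\<^sup>1 \<longlonglongrightarrow> \<upsilon> \<circ> \<theta>\<^sup>-\<^sup>1\<close> in \<open>d\<^sub>\<psi>\<close>. Hence
  \<open>d\<^sub>\<psi>(m\<^sub>n, m\<^sub>n \<circ> \<theta>\<^sup>-\<^sup>1) \<longlonglongrightarrow> d\<^sub>\<psi>(\<upsilon>, \<upsilon> \<circ> \<theta>\<^sup>-\<^sup>1)\<close> almost surely, which
  also makes the limit measurable for the completed measure. If \<open>\<alpha>\<close> is admissible in the
  infimum and \<open>\<beta> > \<alpha>\<close>, then outside an event of probability at most \<open>\<kappa>(\<alpha>) + r \<le> \<kappa>(\<beta>) + r\<close> the two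
  functionals differ by at most \<open>\<kappa>(\<beta>)\<close> for large \<open>n\<close>, so that the Prohorov distance of their laws is at most
  \<open>\<kappa>(\<beta>) + r\<close>. Let \<open>r\<close> tend to \<open>0\<close> and \<open>\<beta>\<close> decrease to the infimum.\<close>

subsection \<open>The pointwise ergodic theorem\<close>

text \<open>\<open>maxsum f T n x = max {S 0, \<dots>, S n}\<close>, where \<open>S k = (\<Sum>i<k. f ((T ^^ i) x))\<close>.\<close>

fun maxsum :: "('a \<Rightarrow> real) \<Rightarrow> ('a \<Rightarrow> 'a) \<Rightarrow> nat \<Rightarrow> 'a \<Rightarrow> real" where
  "maxsum f T 0 x = 0"
| "maxsum f T (Suc n) x = max 0 (f x + maxsum f T n (T x))"

lemma maxsum_nonneg: "0 \<le> maxsum f T n x"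
  by (cases n) auto

lemma maxsum_Suc_mono: "maxsum f T n x \<le> maxsum f T (Suc n) x"
  by (induction n arbitrary: x) (auto simp: max.coboundedI2)

lemma sum_le_maxsum: "(\<Sum>i<n. f ((T ^^ i) x)) \<le> maxsum f T n x"
proof (induction n arbitrary: x)
  case (Suc n)
  have "(\<Sum>i<Suc n. f ((T ^^ i) x)) = f x + (\<Sum>i<n. f ((T ^^ i) (T x)))"
    by (simp add: sum.lessThan_Suc_shift funpow_swap1 del: sum.lessThan_Suc)
  with Suc[of "T x"] show ?case
    by simp
qed simp

text \<open>Abstract setting of the ergodic theorem. It is instantiated below with the law
  \<open>Q\<close> before completion and the map \<open>seq_shift\<close>.\<close>

locale measure_preserving = prob_space M for M :: "'a measure" +
  fixes T :: "'a \<Rightarrow> 'a"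
  assumes T_measurable [measurable]: "T \<in> M \<rightarrow>\<^sub>M M"
    and distr_T: "distr M M T = M"
begin

lemma integrable_comp_T:
  fixes f :: "'a \<Rightarrow> real"
  assumes "integrable M f"
  shows "integrable M (\<lambda>x. f (T x))"
proof -
  have "integrable (distr M M T) f"
    using assms by (simp add: distr_T)
  then show ?thesis
    by (rule integrable_distr[OF T_measurable])
qed

lemma integral_comp_T:
  fixes f :: "'a \<Rightarrow> real"
  assumes "f \<in> borel_measurable M"
  shows "(\<integral>x. f (T x) \<partial>M) = (\<integral>x. f x \<partial>M)"
  using integral_distr[OF T_measurable assms] by (simp add: distr_T)

lemma funpow_T_measurable [measurable]: "(T ^^ i) \<in> M \<rightarrow>\<^sub>M M"
  by (induction i) (auto intro: measurable_compose[OF T_measurable] simp: funpow_Suc_right simp del: funpow.simps(2))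

lemma integrable_maxsum: "integrable M f \<Longrightarrow> integrable M (maxsum f T n)"
proof (induction n)
  case 0
  show ?case
    by (simp add: maxsum.simps(1)[abs_def])
next
  case (Suc n)
  have "maxsum f T (Suc n) = (\<lambda>x. max 0 (f x + maxsum f T n (T x)))"
    by (simp add: fun_eq_iff)
  with Suc show ?case
    by (simp add: integrable_max integrable_comp_T)
qed

text \<open>Garsia's argument. Where the maximum is positive it equals \<open>f x\<close> plus the
  shorter maximum at \<open>T x\<close>, hence is at most \<open>f x\<close> plus the full maximum
  at \<open>T x\<close>. Elsewhere it is 0, while the maximum at \<open>T x\<close> is nonnegative.
  Integrate: by invariance the maximum and its composition with \<open>T\<close> have the same
  integral.\<close>

lemma integral_maxsum_pos:
  assumes f: "integrable M f"
  shows "0 \<le> (\<integral>x. indicator {x \<in> space M. 0 < maxsum f T (Suc n) x} x * f x \<partial>M)"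
proof -
  let ?m = "maxsum f T (Suc n)"
  define A where "A = {x \<in> space M. 0 < ?m x}"
  have m: "integrable M ?m"
    by (rule integrable_maxsum[OF f])
  then have [measurable]: "?m \<in> borel_measurable M"
    by auto
  have [measurable]: "A \<in> sets M"
    unfolding A_def by measurable
  have mT: "integrable M (\<lambda>x. ?m (T x))"
    by (rule integrable_comp_T[OF m])
  have "0 = (\<integral>x. ?m x - ?m (T x) \<partial>M)"
    using m mT integral_comp_T[of ?m] by (simp del: maxsum.simps)
  also have "\<dots> \<le> (\<integral>x. indicator A x * f x \<partial>M)"
  proof (rule integral_mono)
    show "integrable M (\<lambda>x. ?m x - ?m (T x))"
      using m mT by (rule Bochner_Integration.integrable_diff)
    show "integrable M (\<lambda>x. indicator A x * f x)"
      using integrable_mult_indicator[OF _ f, of A] by simp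
    fix x assume x: "x \<in> space M"
    show "?m x - ?m (T x) \<le> indicator A x * f x"
    proof (cases "x \<in> A")
      case True
      then have "?m x = f x + maxsum f T n (T x)"
        by (auto simp: A_def max_def split: if_splits)
      with True maxsum_Suc_mono[of f T n "T x"] show ?thesis
        by (simp del: maxsum.simps)
    next
      case False
      with x have "?m x \<le> 0"
        by (simp add: A_def del: maxsum.simps)
      with False maxsum_nonneg[of f T "Suc n" "T x"] show ?thesis
        by (simp del: maxsum.simps)
    qed
  qed
  finally show ?thesis
    by (simp add: A_def)
qed

text \<open>The maximal ergodic lemma for \<open>indicator A * f\<close>: its partial sums become positive exactly
  on \<open>A\<close>.\<close>

lemma maximal_ergodic:
  fixes f :: "'a \<Rightarrow> real"
  assumes f: "integrable M f" and A [measurable]: "A \<in> sets M" and inv: "T -` A \<inter> space M = A"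
    and pos: "\<And>x. x \<in> A \<Longrightarrow> \<exists>n. 0 < (\<Sum>i<n. f ((T ^^ i) x))"
  shows "0 \<le> (\<integral>x. indicator A x * f x \<partial>M)"
proof -
  define h where "h x = indicator A x * f x" for x
  have h: "integrable M h"
    using integrable_mult_indicator[OF A f] by (simp add: h_def[abs_def])
  then have [measurable]: "h \<in> borel_measurable M"
    by auto
  have [measurable]: "maxsum h T n \<in> borel_measurable M" for n
    using integrable_maxsum[OF h, of n] by auto
  define B where "B n = {x \<in> space M. 0 < maxsum h T (Suc n) x}" for n
  have [measurable]: "B n \<in> sets M" for n
    unfolding B_def by measurable
  \<comment> \<open>Orbits starting in \<open>A\<close> stay there, so on \<open>A\<close> the
    partial sums of \<open>h\<close> and of \<open>f\<close> coincide.\<close>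
  have pow: "(T ^^ i) x \<in> A" if "x \<in> A" for i x
    using that inv by (induction i) auto
  \<comment> \<open>Each point of \<open>A\<close> lies in \<open>B n\<close> for all large
    \<open>n\<close>, and \<open>h\<close> vanishes off \<open>A\<close>. So the nonnegative
    integrals over \<open>B n\<close> converge to the integral of \<open>h\<close>.\<close>
  have "(\<lambda>n. \<integral>x. indicator (B n) x * h x \<partial>M) \<longlonglongrightarrow> (\<integral>x. h x \<partial>M)"
  proof (rule integral_dominated_convergence[where w = "\<lambda>x. norm (h x)"])
    show "integrable M (\<lambda>x. norm (h x))"
      using h by simp
    show "AE x in M. norm (indicator (B n) x * h x) \<le> norm (h x)" for n
      by (simp add: abs_mult mult_left_le_one_le)
    show "AE x in M. (\<lambda>n. indicator (B n) x * h x) \<longlonglongrightarrow> h x"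
    proof (rule AE_I2)
      fix x assume "x \<in> space M"
      show "(\<lambda>n. indicator (B n) x * h x) \<longlonglongrightarrow> h x"
      proof (cases "x \<in> A")
        case True
        from pos[OF True] obtain n where n: "0 < (\<Sum>i<n. f ((T ^^ i) x))" ..
        also have "(\<Sum>i<n. f ((T ^^ i) x)) = (\<Sum>i<n. h ((T ^^ i) x))"
          using pow[OF True] by (simp add: h_def)
        also note sum_le_maxsum
        finally have pos_n: "0 < maxsum h T n x" .
        have "x \<in> B m" if "m \<ge> n" for m
        proof -
          have "maxsum h T n x \<le> maxsum h T (Suc m) x"
            by (rule lift_Suc_mono_le[where f = "\<lambda>n. maxsum h T n x", OF maxsum_Suc_mono le_SucI[OF that]])
          with pos_n \<open>x \<in> space M\<close> show ?thesis
            by (simp add: B_def del: maxsum.simps)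
        qed
        then have "\<forall>\<^sub>F m in sequentially. indicator (B m) x * h x = h x"
          unfolding eventually_sequentially by (intro exI[of _ n]) simp
        then show ?thesis
          by (rule tendsto_eventually)
      next
        case False
        then show ?thesis
          by (simp add: h_def)
      qed
    qed
  qed measurable
  moreover have "0 \<le> (\<integral>x. indicator (B n) x * h x \<partial>M)" for n
    using integral_maxsum_pos[OF h, of n] by (simp add: B_def)
  ultimately have "0 \<le> (\<integral>x. h x \<partial>M)"
    by (intro LIMSEQ_le_const) auto
  then show ?thesis
    by (simp add: h_def)
qed

text \<open>Put \<open>h = f - g - e\<close> and let \<open>A\<close> be the set where the partial
  sums of \<open>h\<close> are unbounded above. It is invariant, so the maximal ergodic lemma and
  \<open>eq\<close> give \<open>0 \<le> - e * prob A\<close>, that is, \<open>A\<close> is null. Off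
  \<open>A\<close> the sums of \<open>h\<close> are bounded, which is the claim since
  \<open>g\<close> is constant along orbits.\<close>

lemma AE_ergodic_sums_bounded_above:
  fixes f g :: "'a \<Rightarrow> real"
  assumes f: "integrable M f" and g: "integrable M g"
    and g_inv: "\<And>x. x \<in> space M \<Longrightarrow> g (T x) = g x"
    and eq: "\<And>A. A \<in> sets M \<Longrightarrow> T -` A \<inter> space M = A \<Longrightarrow>
               (\<integral>x. indicator A x * f x \<partial>M) = (\<integral>x. indicator A x * g x \<partial>M)"
    and e: "0 < e"
  shows "AE x in M. \<exists>C. \<forall>n. (\<Sum>i<n. f ((T ^^ i) x)) \<le> n * (g x + e) + C"
proof -
  have [measurable]: "f \<in> borel_measurable M" "g \<in> borel_measurable M"
    using f g by auto
  have Tspace: "T x \<in> space M" if "x \<in> space M" for x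
    using measurable_space[OF T_measurable that] .
  define h where "h x = f x - g x - e" for x
  define S where "S n x = (\<Sum>i<n. h ((T ^^ i) x))" for n x
  have [measurable]: "h \<in> borel_measurable M"
    unfolding h_def by measurable
  have S_Suc: "S (Suc n) x = h x + S n (T x)" for n x
    by (simp add: S_def sum.lessThan_Suc_shift funpow_swap1 del: sum.lessThan_Suc)
  have S_eq: "S n x = (\<Sum>i<n. f ((T ^^ i) x)) - n * (g x + e)" if "x \<in> space M" for n x
  proof -
    have "(T ^^ i) x \<in> space M \<and> g ((T ^^ i) x) = g x" for i
      using that by (induction i) (auto simp: g_inv Tspace)
    then show ?thesis
      by (simp add: S_def h_def sum_subtractf algebra_simps)
  qed
  \<comment> \<open>Unboundedness does not change when a single summand is added or dropped, which
    yields invariance. Natural bounds \<open>K\<close> keep the condition countable, and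
    \<open>K = 0\<close> supplies the positive sum that \<open>maximal_ergodic\<close> asks
    for.\<close>
  define A where "A = {x \<in> space M. \<forall>K::nat. \<exists>n. K < S n x}"
  have A [measurable]: "A \<in> sets M"
    unfolding A_def S_def by measurable
  have inv: "T -` A \<inter> space M = A"
  proof (intro equalityI subsetI)
    fix x assume "x \<in> T -` A \<inter> space M"
    then have x: "x \<in> space M" and TA: "\<And>K::nat. \<exists>n. K < S n (T x)"
      by (auto simp: A_def)
    have "\<exists>n. K < S n x" for K :: nat
    proof -
      obtain L :: nat where "K - h x < L"
        using reals_Archimedean2 by blast
      moreover obtain n where "L < S n (T x)"
        using TA by blast
      ultimately have "K < S (Suc n) x"
        by (simp add: S_Suc)
      then show ?thesis ..
    qed
    with x show "x \<in> A"
      by (simp add: A_def)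
  next
    fix x assume "x \<in> A"
    then have x: "x \<in> space M" and xA: "\<And>K::nat. \<exists>n. K < S n x"
      by (auto simp: A_def)
    have "\<exists>n. K < S n (T x)" for K :: nat
    proof -
      obtain L :: nat where L: "K + h x < L"
        using reals_Archimedean2 by blast
      obtain n where n: "L < S n x"
        using xA by blast
      \<comment> \<open>The empty sum is 0 and cannot exceed the natural number \<open>L\<close>, so
        at least one summand is there to be dropped.\<close>
      then obtain m where "n = Suc m"
        by (cases n) (auto simp: S_def)
      with L n have "K < S m (T x)"
        by (simp add: S_Suc)
      then show ?thesis ..
    qed
    with x show "x \<in> T -` A \<inter> space M"
      by (simp add: A_def Tspace)
  qed
  have int_h: "integrable M h"
    unfolding h_def using f g by auto
  have "0 \<le> (\<integral>x. indicator A x * h x \<partial>M)"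
  proof (rule maximal_ergodic[OF int_h A inv])
    fix x assume "x \<in> A"
    then have "\<exists>n. real 0 < S n x"
      unfolding A_def by blast
    then show "\<exists>n. 0 < (\<Sum>i<n. h ((T ^^ i) x))"
      by (simp add: S_def)
  qed
  also have "(\<integral>x. indicator A x * h x \<partial>M) =
      (\<integral>x. indicator A x * f x \<partial>M) - (\<integral>x. indicator A x * g x \<partial>M) - e * prob A"
  proof -
    have "integrable M (\<lambda>x. indicator A x * f x)" "integrable M (\<lambda>x. indicator A x * g x)"
      using integrable_mult_indicator[OF A f] integrable_mult_indicator[OF A g] by simp_all
    moreover have "integrable M (\<lambda>x. indicator A x * e)"
      by (intro integrable_mult_left integrable_real_indicator) (auto simp: less_top[symmetric])
    ultimately have "(\<integral>x. indicator A x * f x - indicator A x * g x - indicator A x * e \<partial>M) =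
        (\<integral>x. indicator A x * f x \<partial>M) - (\<integral>x. indicator A x * g x \<partial>M) - (\<integral>x. indicator A x * e \<partial>M)"
      by (simp only: Bochner_Integration.integral_diff Bochner_Integration.integrable_diff)
    then show ?thesis
      by (simp add: h_def right_diff_distrib mult.commute)
  qed
  also have "\<dots> = - e * prob A"
    by (simp add: eq[OF A inv])
  finally have "prob A = 0"
    using e by (auto simp: mult_le_0_iff measure_nonneg intro!: antisym)
  then have "AE x in M. x \<notin> A"
    by (simp add: emeasure_eq_measure AE_iff_null_sets[symmetric] null_sets_def AE_not_in)
  then show ?thesis
  proof (rule AE_mp, intro AE_I2 impI)
    fix x assume x: "x \<in> space M" and "x \<notin> A"
    then obtain K :: nat where "\<And>n. S n x \<le> K"
      by (auto simp: A_def not_less)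
    then have "\<forall>n. (\<Sum>i<n. f ((T ^^ i) x)) \<le> n * (g x + e) + K"
      using S_eq[OF x] by (simp add: algebra_simps)
    then show "\<exists>C. \<forall>n. (\<Sum>i<n. f ((T ^^ i) x)) \<le> n * (g x + e) + C" ..
  qed
qed

text \<open>The conditions on \<open>g\<close> make it a conditional expectation of \<open>f\<close>
  given the invariant sets. The preceding bound, applied to \<open>f\<close>, \<open>g\<close> and
  to \<open>-f\<close>, \<open>-g\<close> with \<open>e = 1/(k+1)\<close> for all \<open>k\<close>
  at once, confines the averages to a band around \<open>g x\<close>; the constants disappear after
  division by \<open>n\<close>.\<close>

theorem pointwise_ergodic:
  fixes f g :: "'a \<Rightarrow> real"
  assumes f: "integrable M f" and g: "integrable M g"
    and g_inv: "\<And>x. x \<in> space M \<Longrightarrow> g (T x) = g x"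
    and eq: "\<And>A. A \<in> sets M \<Longrightarrow> T -` A \<inter> space M = A \<Longrightarrow>
               (\<integral>x. indicator A x * f x \<partial>M) = (\<integral>x. indicator A x * g x \<partial>M)"
  shows "AE x in M. (\<lambda>n. (\<Sum>i<n. f ((T ^^ i) x)) / n) \<longlonglongrightarrow> g x"
proof -
  have "AE x in M. \<forall>k. \<exists>C. \<forall>n. (\<Sum>i<n. f ((T ^^ i) x)) \<le> n * (g x + inverse (real (Suc k))) + C"
    unfolding AE_all_countable
    by (intro allI AE_ergodic_sums_bounded_above f g g_inv eq) auto
  moreover have "AE x in M. \<forall>k. \<exists>C. \<forall>n. (\<Sum>i<n. - f ((T ^^ i) x)) \<le> n * (- g x + inverse (real (Suc k))) + C"
    unfolding AE_all_countable
    by (intro allI AE_ergodic_sums_bounded_above[where f = "\<lambda>x. - f x" and g = "\<lambda>x. - g x"])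
      (auto simp: f g g_inv eq)
  ultimately show ?thesis
  proof eventually_elim
    case (elim x)
    show ?case
    proof (rule LIMSEQ_I)
      fix r :: real assume "0 < r"
      then obtain k where k: "inverse (real (Suc k)) < r / 2"
        using reals_Archimedean[of "r / 2"] by auto
      define S where "S n = (\<Sum>i<n. f ((T ^^ i) x))" for n
      obtain C where C: "\<And>n. S n \<le> n * (g x + inverse (real (Suc k))) + C"
        unfolding S_def using elim(1) by blast
      obtain D where "\<And>n. (\<Sum>i<n. - f ((T ^^ i) x)) \<le> n * (- g x + inverse (real (Suc k))) + D"
        using elim(2) by blast
      then have D: "- S n \<le> n * (- g x + inverse (real (Suc k))) + D" for n
        by (simp add: S_def sum_negf)
      \<comment> \<open>Half of \<open>r\<close> absorbs the slack from \<open>k\<close>, the other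
        half the two constants \<open>C\<close> and \<open>D\<close>.\<close>
      obtain N :: nat where N: "2 * (\<bar>C\<bar> + \<bar>D\<bar>) / r < N"
        using reals_Archimedean2 by blast
      have "norm (S n / n - g x) < r" if "N \<le> n" for n
      proof -
        have "2 * (\<bar>C\<bar> + \<bar>D\<bar>) / r < n"
          using N that by linarith
        moreover have "0 \<le> 2 * (\<bar>C\<bar> + \<bar>D\<bar>) / r"
          using \<open>0 < r\<close> by simp
        ultimately have n: "0 < real n" and bnd: "\<bar>C\<bar> + \<bar>D\<bar> < n * (r / 2)"
          using \<open>0 < r\<close> by (linarith, simp add: field_simps)
        have "n * inverse (real (Suc k)) \<le> n * (r / 2)"
          using k n by (intro mult_left_mono) auto
        moreover have "S n - n * g x \<le> n * inverse (real (Suc k)) + C"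
            "n * g x - S n \<le> n * inverse (real (Suc k)) + D"
          using C[of n] D[of n] by (simp_all add: algebra_simps)
        ultimately have "\<bar>S n - n * g x\<bar> < n * (r / 2) + n * (r / 2)"
          using bnd by linarith
        then have "\<bar>S n - n * g x\<bar> / n < r"
          using n by (simp add: pos_divide_less_eq field_simps)
        moreover have "\<bar>S n - n * g x\<bar> / n = \<bar>S n / n - g x\<bar>"
        proof -
          have "S n / n - g x = (S n - n * g x) / n"
            using n by (simp add: field_simps)
          then show ?thesis
            using n by (simp add: abs_divide)
        qed
        ultimately show ?thesis
          by simp
      qed
      then show "\<exists>N. \<forall>n\<ge>N. norm ((\<Sum>i<n. f ((T ^^ i) x)) / n - g x) < r"
        unfolding S_def by blast
    qed
  qed
qed

end

subsection \<open>The Prohorov distance\<close>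

lemma mem_enlargement: "x \<in> enlargement B e \<longleftrightarrow> (\<exists>y\<in>B. dist y x < e)"
  by (simp add: enlargement_def INF_less_iff)

lemma open_enlargement: "open (enlargement B e)"
proof -
  have "enlargement B e = (\<Union>y\<in>B. ball y e)"
    by (auto simp: mem_enlargement)
  then show ?thesis
    by auto
qed

lemma enlargement_borel [measurable]: "enlargement B e \<in> sets borel"
  using open_enlargement by (rule borel_open)

definition prohorov_bounds :: "'a::metric_space measure \<Rightarrow> 'a measure \<Rightarrow> real set" where
  "prohorov_bounds \<mu> \<nu> =
     {e. 0 < e \<and> (\<forall>B\<in>sets borel. measure \<mu> B \<le> measure \<nu> (enlargement B e) + e)}"

lemma prohorov_eq_Inf: "prohorov \<mu> \<nu> = Inf (prohorov_bounds \<mu> \<nu>)"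
  by (simp add: prohorov_def prohorov_bounds_def)

lemma bdd_below_prohorov_bounds: "bdd_below (prohorov_bounds \<mu> \<nu>)"
  by (rule bdd_belowI[of _ 0]) (simp add: prohorov_bounds_def)

lemma prohorov_le: "e \<in> prohorov_bounds \<mu> \<nu> \<Longrightarrow> prohorov \<mu> \<nu> \<le> e"
  unfolding prohorov_eq_Inf by (rule cInf_lower[OF _ bdd_below_prohorov_bounds])

text \<open>The set of bounds is therefore nonempty, so the real \<open>Inf\<close> in
  \<open>prohorov\<close> is a genuine infimum.\<close>

lemma one_in_prohorov_bounds:
  assumes "\<mu> \<in> space (prob_algebra borel)"
  shows "1 \<in> prohorov_bounds \<mu> \<nu>"
proof -
  interpret prob_space \<mu>
    using assms by (simp add: space_prob_algebra)
  have "measure \<mu> B \<le> measure \<nu> C + 1" for B C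
    using prob_le_1[of B] measure_nonneg[of \<nu> C] by linarith
  then show ?thesis
    by (simp add: prohorov_bounds_def)
qed

lemma prohorov_nonneg: "\<mu> \<in> space (prob_algebra borel) \<Longrightarrow> 0 \<le> prohorov \<mu> \<nu>"
  unfolding prohorov_eq_Inf
proof (rule cInf_greatest)
  assume "\<mu> \<in> space (prob_algebra borel)"
  then show "prohorov_bounds \<mu> \<nu> \<noteq> {}"
    using one_in_prohorov_bounds by blast
qed (simp add: prohorov_bounds_def)

text \<open>Nearly optimal bounds add up, because an enlargement by \<open>e\<close> followed by one
  by \<open>e'\<close> stays inside the enlargement by \<open>e + e'\<close>.\<close>

lemma prohorov_triangle:
  assumes "\<mu> \<in> space (prob_algebra borel)" "\<nu> \<in> space (prob_algebra borel)"
    "\<rho> \<in> space (prob_algebra borel)"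
  shows "prohorov \<mu> \<rho> \<le> prohorov \<mu> \<nu> + prohorov \<nu> \<rho>"
proof (rule field_le_epsilon)
  fix r :: real assume "0 < r"
  interpret \<rho>: prob_space \<rho>
    using assms by (simp add: space_prob_algebra)
  have sets_\<rho> [measurable_cong, simp]: "sets \<rho> = sets borel"
    using assms by (simp add: space_prob_algebra)
  have "\<exists>e\<in>prohorov_bounds \<mu> \<nu>. e < prohorov \<mu> \<nu> + r / 2"
    using \<open>0 < r\<close> one_in_prohorov_bounds[OF assms(1), of \<nu>]
    by (intro cInf_lessD) (auto simp: prohorov_eq_Inf)
  then obtain e where e: "e \<in> prohorov_bounds \<mu> \<nu>" "e < prohorov \<mu> \<nu> + r / 2" ..
  have "\<exists>e\<in>prohorov_bounds \<nu> \<rho>. e < prohorov \<nu> \<rho> + r / 2"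
    using \<open>0 < r\<close> one_in_prohorov_bounds[OF assms(2), of \<rho>]
    by (intro cInf_lessD) (auto simp: prohorov_eq_Inf)
  then obtain e' where e': "e' \<in> prohorov_bounds \<nu> \<rho>" "e' < prohorov \<nu> \<rho> + r / 2" ..
  have "e + e' \<in> prohorov_bounds \<mu> \<rho>"
    unfolding prohorov_bounds_def
  proof (intro CollectI conjI ballI)
    show "0 < e + e'"
      using e e' by (simp add: prohorov_bounds_def)
    fix B :: "'a set" assume "B \<in> sets borel"
    then have "measure \<mu> B \<le> measure \<nu> (enlargement B e) + e"
      using e by (simp add: prohorov_bounds_def)
    also have "measure \<nu> (enlargement B e) \<le> measure \<rho> (enlargement (enlargement B e) e') + e'"
      using e' by (simp add: prohorov_bounds_def)
    also have "measure \<rho> (enlargement (enlargement B e) e') \<le> measure \<rho> (enlargement B (e + e'))"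
    proof (rule \<rho>.finite_measure_mono)
      show "enlargement (enlargement B e) e' \<subseteq> enlargement B (e + e')"
      proof
        fix x assume "x \<in> enlargement (enlargement B e) e'"
        then obtain y z where "dist z x < e'" "y \<in> B" "dist y z < e"
          by (auto simp: mem_enlargement)
        moreover have "dist y x \<le> dist y z + dist z x"
          by (rule dist_triangle)
        ultimately show "x \<in> enlargement B (e + e')"
          by (auto simp: mem_enlargement intro!: bexI[of _ y])
      qed
    qed simp
    finally show "measure \<mu> B \<le> measure \<rho> (enlargement B (e + e')) + (e + e')"
      by simp
  qed
  then have "prohorov \<mu> \<rho> \<le> e + e'"
    by (rule prohorov_le)
  with e e' show "prohorov \<mu> \<rho> \<le> prohorov \<mu> \<nu> + prohorov \<nu> \<rho> + r"
    by linarith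
qed

text \<open>Coupling bound: if \<open>X x\<close> lies in \<open>B\<close>, then either
  \<open>Y x\<close> lies in the \<open>e\<close>-enlargement of \<open>B\<close> or the two values
  are at distance at least \<open>e\<close>.\<close>

lemma (in prob_space) prohorov_distr_le:
  fixes X Y :: "'a \<Rightarrow> 'b::{metric_space, second_countable_topology}"
  assumes X [measurable]: "X \<in> borel_measurable M" and Y [measurable]: "Y \<in> borel_measurable M"
    and e: "0 < e" and prob: "prob {x \<in> space M. e \<le> dist (X x) (Y x)} \<le> e"
  shows "prohorov (distr M borel X) (distr M borel Y) \<le> e"
proof (rule prohorov_le, unfold prohorov_bounds_def, intro CollectI conjI ballI)
  fix B :: "'b set" assume [measurable]: "B \<in> sets borel"
  let ?D = "{x \<in> space M. e \<le> dist (X x) (Y x)}"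
  have "prob (X -` B \<inter> space M) \<le> prob ((Y -` enlargement B e \<inter> space M) \<union> ?D)"
    by (rule finite_measure_mono) (auto simp: mem_enlargement not_le[symmetric])
  also have "\<dots> \<le> prob (Y -` enlargement B e \<inter> space M) + prob ?D"
    by (rule measure_Un_le) measurable
  finally show "measure (distr M borel X) B \<le> measure (distr M borel Y) (enlargement B e) + e"
    using prob by (simp add: measure_distr)
qed (fact e)

text \<open>A Borel set \<open>B\<close> is approximated by the union of the cells that meet it, which is contained
  in the \<open>e\<close>-enlargement of \<open>B\<close>.\<close>

lemma prohorov_le_cells:
  fixes A :: "'i \<Rightarrow> 'a::metric_space set"
  assumes \<mu>: "\<mu> \<in> space (prob_algebra borel)" and \<nu>: "\<nu> \<in> space (prob_algebra borel)"
    and J: "finite J" and A: "\<And>j. j \<in> J \<Longrightarrow> A j \<in> sets borel" "disjoint_family_on A J"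
    and mesh: "\<And>j x y. j \<in> J \<Longrightarrow> x \<in> A j \<Longrightarrow> y \<in> A j \<Longrightarrow> dist x y < e"
    and close: "(\<Sum>j\<in>J. \<bar>measure \<mu> (A j) - measure \<nu> (A j)\<bar>) \<le> a"
    and tail: "1 - b \<le> measure \<mu> (\<Union>j\<in>J. A j)"
    and e: "0 < e" "a + b \<le> e"
  shows "prohorov \<mu> \<nu> \<le> e"
proof (rule prohorov_le, unfold prohorov_bounds_def, intro CollectI conjI ballI)
  interpret \<mu>: prob_space \<mu>
    using \<mu> by (simp add: space_prob_algebra)
  interpret \<nu>: prob_space \<nu>
    using \<nu> by (simp add: space_prob_algebra)
  have sets_\<mu> [measurable_cong, simp]: "sets \<mu> = sets borel"
    using \<mu> by (simp add: space_prob_algebra)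
  have sets_\<nu> [measurable_cong, simp]: "sets \<nu> = sets borel"
    using \<nu> by (simp add: space_prob_algebra)
  have space_\<mu>: "space \<mu> = UNIV"
    using sets_eq_imp_space_eq[OF sets_\<mu>] by simp
  fix B :: "'a set" assume [measurable]: "B \<in> sets borel"
  define U where "U = (\<Union>j\<in>J. A j)"
  have [measurable]: "U \<in> sets borel"
    unfolding U_def using J A(1) by auto
  define K where "K = {j\<in>J. A j \<inter> B \<noteq> {}}"
  have K: "finite K" "K \<subseteq> J"
    using J by (auto simp: K_def)
  have disj: "disjoint_family_on A K"
    using A(2) K(2) by (rule disjoint_family_on_mono[rotated])
  \<comment> \<open>\<open>B\<close> is charged to the cells meeting it and to the complement of
    \<open>U\<close>, of mass at most \<open>b\<close>. Exchanging \<open>\<mu>\<close> for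
    \<open>\<nu>\<close> on those cells costs at most \<open>a\<close>.\<close>
  have "measure \<mu> B \<le> measure \<mu> ((\<Union>j\<in>K. A j) \<union> (space \<mu> - U))"
  proof (rule \<mu>.finite_measure_mono)
    show "B \<subseteq> (\<Union>j\<in>K. A j) \<union> (space \<mu> - U)"
      by (auto simp: K_def U_def space_\<mu>)
    show "(\<Union>j\<in>K. A j) \<union> (space \<mu> - U) \<in> sets \<mu>"
      using K A(1) by (intro sets.Un sets.finite_UN sets.compl_sets) auto
  qed
  also have "\<dots> \<le> measure \<mu> (\<Union>j\<in>K. A j) + measure \<mu> (space \<mu> - U)"
    using K A(1) by (intro measure_Un_le sets.finite_UN sets.compl_sets) auto
  also have "measure \<mu> (space \<mu> - U) \<le> b"
    using tail by (simp add: \<mu>.prob_compl U_def[symmetric])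
  also have "measure \<mu> (\<Union>j\<in>K. A j) = (\<Sum>j\<in>K. measure \<mu> (A j))"
    using K A(1) disj by (intro \<mu>.finite_measure_finite_Union) auto
  also have "\<dots> \<le> (\<Sum>j\<in>K. measure \<nu> (A j) + \<bar>measure \<mu> (A j) - measure \<nu> (A j)\<bar>)"
    by (rule sum_mono) simp
  also have "\<dots> = (\<Sum>j\<in>K. measure \<nu> (A j)) + (\<Sum>j\<in>K. \<bar>measure \<mu> (A j) - measure \<nu> (A j)\<bar>)"
    by (rule sum.distrib)
  also have "(\<Sum>j\<in>K. \<bar>measure \<mu> (A j) - measure \<nu> (A j)\<bar>) \<le> (\<Sum>j\<in>J. \<bar>measure \<mu> (A j) - measure \<nu> (A j)\<bar>)"
    using J K by (intro sum_mono2) auto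
  also have "(\<Sum>j\<in>K. measure \<nu> (A j)) = measure \<nu> (\<Union>j\<in>K. A j)"
    using K A(1) disj by (intro \<nu>.finite_measure_finite_Union[symmetric]) auto
  also have "\<dots> \<le> measure \<nu> (enlargement B e)"
  proof (rule \<nu>.finite_measure_mono)
    show "(\<Union>j\<in>K. A j) \<subseteq> enlargement B e"
      using mesh by (auto simp: K_def mem_enlargement) blast
  qed simp
  finally show "measure \<mu> B \<le> measure \<nu> (enlargement B e) + e"
    using close e by simp
qed (fact e)

text \<open>Balls of radius \<open>e / 2\<close> around a countable dense set cover the space;
  removing from each ball the earlier ones makes them disjoint.\<close>

lemma borel_partition_mesh:
  fixes e :: real
  assumes "0 < e"
  obtains A :: "nat \<Rightarrow> 'a::{metric_space, second_countable_topology} set"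
  where "\<And>j. A j \<in> sets borel" "disjoint_family A" "(\<Union>j. A j) = UNIV"
    "\<And>j x y. x \<in> A j \<Longrightarrow> y \<in> A j \<Longrightarrow> dist x y < e"
proof -
  obtain D :: "'a set" where D: "countable D" "\<And>X. open X \<Longrightarrow> X \<noteq> {} \<Longrightarrow> \<exists>d\<in>D. d \<in> X"
    using countable_dense_exists[where 'a = 'a] by auto
  have "D \<noteq> {}"
    using D(2)[of UNIV] by auto
  define C where "C j = ball (from_nat_into D j) (e / 2)" for j
  have cover: "(\<Union>j. C j) = UNIV"
  proof (intro equalityI subsetI UNIV_I)
    fix x :: 'a
    have "open (ball x (e / 2))" "ball x (e / 2) \<noteq> {}"
      using assms by auto
    then obtain d where d: "d \<in> D" "d \<in> ball x (e / 2)"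
      using D(2) by blast
    then have "x \<in> C (to_nat_on D d)"
      using D(1) by (simp add: C_def dist_commute)
    then show "x \<in> (\<Union>j. C j)"
      by blast
  qed
  show thesis
  proof
    show "disjointed C j \<in> sets borel" for j
      unfolding disjointed_def C_def by auto
    show "disjoint_family (disjointed C)"
      by (rule disjoint_family_disjointed)
    show "(\<Union>j. disjointed C j) = UNIV"
      using cover by (simp add: UN_disjointed_eq)
    fix j x y assume "x \<in> disjointed C j" "y \<in> disjointed C j"
    then have "dist (from_nat_into D j) x < e / 2" "dist (from_nat_into D j) y < e / 2"
      by (auto simp: disjointed_def C_def)
    then show "dist x y < e"
      by (metis dist_commute dist_triangle_half_l)
  qed
qed

text \<open>Convergence on countably many cells is enough, so that later a single null set suffices.
  For a given mesh, finitely many cells carry nearly all the mass of \<open>\<nu>\<close>, and on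
  these the masses converge jointly. Both argument orders are recorded because both enter
  \<open>dpsi_diff_le\<close>.\<close>

lemma prohorov_tendsto_0:
  fixes A :: "nat \<Rightarrow> nat \<Rightarrow> 'a::metric_space set"
  assumes \<mu>: "\<forall>\<^sub>F n in sequentially. \<mu> n \<in> space (prob_algebra borel)"
    and \<nu>: "\<nu> \<in> space (prob_algebra borel)"
    and A: "\<And>k j. A k j \<in> sets borel" "\<And>k. disjoint_family (A k)" "\<And>k. (\<Union>j. A k j) = UNIV"
    and mesh: "\<And>k j x y. x \<in> A k j \<Longrightarrow> y \<in> A k j \<Longrightarrow> dist x y < inverse (real (Suc k))"
    and lim: "\<And>k j. (\<lambda>n. measure (\<mu> n) (A k j)) \<longlonglongrightarrow> measure \<nu> (A k j)"
  shows "(\<lambda>n. prohorov (\<mu> n) \<nu>) \<longlonglongrightarrow> 0" and "(\<lambda>n. prohorov \<nu> (\<mu> n)) \<longlonglongrightarrow> 0"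
proof -
  interpret \<nu>: prob_space \<nu>
    using \<nu> by (simp add: space_prob_algebra)
  have sets_\<nu> [measurable_cong, simp]: "sets \<nu> = sets borel"
    using \<nu> by (simp add: space_prob_algebra)
  have space_\<nu>: "space \<nu> = UNIV"
    using sets_eq_imp_space_eq[OF sets_\<nu>] by simp
  have le: "\<forall>\<^sub>F n in sequentially. prohorov (\<mu> n) \<nu> \<le> inverse (real (Suc k)) \<and>
      prohorov \<nu> (\<mu> n) \<le> inverse (real (Suc k))" for k
  proof -
    define e where "e = inverse (real (Suc k))"
    have e: "0 < e"
      by (simp add: e_def)
    have "(\<lambda>j. measure \<nu> (\<Union>i\<le>j. A k i)) \<longlonglongrightarrow> measure \<nu> (\<Union>j. \<Union>i\<le>j. A k i)"
      using A(1) by (intro \<nu>.finite_Lim_measure_incseq) (auto simp: incseq_def intro: order_trans)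
    also have "(\<Union>j. \<Union>i\<le>j. A k i) = space \<nu>"
      using A(3)[of k] by (auto simp: space_\<nu>)
    finally have "(\<lambda>j. measure \<nu> (\<Union>i\<le>j. A k i)) \<longlonglongrightarrow> 1"
      by (simp add: \<nu>.prob_space)
    then have "\<forall>\<^sub>F j in sequentially. 1 - e / 3 < measure \<nu> (\<Union>i\<le>j. A k i)"
      using e by (intro order_tendstoD) auto
    then obtain j where j: "1 - e / 3 < measure \<nu> (\<Union>i\<le>j. A k i)"
      by (auto simp: eventually_sequentially)
    have "(\<lambda>n. \<Sum>i\<le>j. \<bar>measure (\<mu> n) (A k i) - measure \<nu> (A k i)\<bar>) \<longlonglongrightarrow> (\<Sum>i\<le>j. \<bar>measure \<nu> (A k i) - measure \<nu> (A k i)\<bar>)"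
      by (intro tendsto_intros lim)
    then have "\<forall>\<^sub>F n in sequentially. (\<Sum>i\<le>j. \<bar>measure (\<mu> n) (A k i) - measure \<nu> (A k i)\<bar>) < e / 3"
      using e by (intro order_tendstoD) auto
    with \<mu> show ?thesis
    proof eventually_elim
      case (elim n)
      interpret \<mu>: prob_space "\<mu> n"
        using elim by (simp add: space_prob_algebra)
      have sets_\<mu>: "sets (\<mu> n) = sets borel"
        using elim by (simp add: space_prob_algebra)
      have disj: "disjoint_family_on (A k) {..j}"
        using A(2) by (rule disjoint_family_on_mono[rotated]) simp
      \<comment> \<open>Mass of \<open>\<mu> n\<close> outside the chosen cells:
        \<open>e / 3\<close> for the tail of \<open>\<nu>\<close> plus \<open>e / 3\<close> for the
        discrepancy on the cells. This explains the two different values of \<open>b\<close>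
        below.\<close>
      have "\<bar>measure (\<mu> n) (\<Union>i\<le>j. A k i) - measure \<nu> (\<Union>i\<le>j. A k i)\<bar> =
          \<bar>\<Sum>i\<le>j. measure (\<mu> n) (A k i) - measure \<nu> (A k i)\<bar>"
        using A(1) disj
        by (simp add: \<mu>.finite_measure_finite_Union \<nu>.finite_measure_finite_Union sets_\<mu> image_subset_iff
            sum_subtractf)
      also have "\<dots> \<le> (\<Sum>i\<le>j. \<bar>measure (\<mu> n) (A k i) - measure \<nu> (A k i)\<bar>)"
        by (rule sum_abs)
      finally have tail: "1 - 2 * e / 3 \<le> measure (\<mu> n) (\<Union>i\<le>j. A k i)"
        using j elim by linarith
      have "prohorov (\<mu> n) \<nu> \<le> e"
        by (rule prohorov_le_cells[where J = "{..j}" and A = "A k" and a = "e / 3" and b = "2 * e / 3"])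
          (use elim e tail \<nu> A(1) disj mesh[of _ k, folded e_def] in \<open>auto\<close>)
      moreover have "prohorov \<nu> (\<mu> n) \<le> e"
        by (rule prohorov_le_cells[where J = "{..j}" and A = "A k" and a = "e / 3" and b = "e / 3"])
          (use elim e j \<nu> A(1) disj mesh[of _ k, folded e_def] in \<open>auto simp: abs_minus_commute\<close>)
      ultimately show ?case
        by (simp add: e_def)
    qed
  qed
  have nonneg: "\<forall>\<^sub>F n in sequentially. 0 \<le> prohorov (\<mu> n) \<nu> \<and> 0 \<le> prohorov \<nu> (\<mu> n)"
    using \<mu> by eventually_elim (use \<nu> in \<open>auto intro: prohorov_nonneg\<close>)
  have "\<forall>\<^sub>F n in sequentially. \<bar>prohorov (\<mu> n) \<nu>\<bar> < r \<and> \<bar>prohorov \<nu> (\<mu> n)\<bar> < r" if r: "0 < r" for r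
  proof -
    obtain k where "inverse (real (Suc k)) < r"
      using reals_Archimedean[OF r] ..
    then show ?thesis
      by (intro eventually_mono[OF eventually_conj[OF le[of k] nonneg]]) auto
  qed
  then show "(\<lambda>n. prohorov (\<mu> n) \<nu>) \<longlonglongrightarrow> 0" and "(\<lambda>n. prohorov \<nu> (\<mu> n)) \<longlonglongrightarrow> 0"
    by (simp_all add: tendsto_iff dist_real_def eventually_conj_iff)
qed


text \<open>Two triangle inequalities for each sign of the difference. The upper and the lower
  estimate traverse the pairs in opposite directions, hence both orders on the right.\<close>

lemma dpsi_diff_le:
  assumes "\<mu> \<in> space (prob_algebra borel)" "\<nu> \<in> space (prob_algebra borel)"
    "\<mu>' \<in> space (prob_algebra borel)" "\<nu>' \<in> space (prob_algebra borel)"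
  shows "\<bar>dpsi \<psi> \<mu> \<nu> - dpsi \<psi> \<mu>' \<nu>'\<bar> \<le>
    dpsi \<psi> \<mu> \<mu>' + dpsi \<psi> \<mu>' \<mu> + dpsi \<psi> \<nu> \<nu>' + dpsi \<psi> \<nu>' \<nu>"
proof -
  have "prohorov \<mu> \<nu> \<le> prohorov \<mu> \<mu>' + prohorov \<mu>' \<nu>' + prohorov \<nu>' \<nu>"
    using prohorov_triangle[of \<mu> \<mu>' \<nu>] prohorov_triangle[of \<mu>' \<nu>' \<nu>] assms by linarith
  moreover have "prohorov \<mu>' \<nu>' \<le> prohorov \<mu>' \<mu> + prohorov \<mu> \<nu> + prohorov \<nu> \<nu>'"
    using prohorov_triangle[of \<mu>' \<mu> \<nu>'] prohorov_triangle[of \<mu> \<nu> \<nu>'] assms by linarith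
  moreover have "0 \<le> prohorov \<mu> \<mu>'" "0 \<le> prohorov \<mu>' \<mu>" "0 \<le> prohorov \<nu> \<nu>'" "0 \<le> prohorov \<nu>' \<nu>"
    using assms by (auto intro: prohorov_nonneg)
  ultimately show ?thesis
    unfolding dpsi_def by linarith
qed

subsection \<open>Empirical measures\<close>

text \<open>A sequence is viewed as a random variable on a uniformly drawn index, which reduces
  integrals and images of empirical measures to change of variables. Positivity of \<open>n\<close>
  makes the index set nonempty.\<close>

lemma empirical_eq_distr:
  assumes "0 < n"
  shows "empirical n \<omega> = distr (measure_pmf (pmf_of_set {..<n})) borel \<omega>"
proof (rule measure_eqI)
  fix B assume "B \<in> sets (empirical n \<omega>)"
  then have B: "B \<in> sets borel"
    by simp
  have ne: "{..<n} \<noteq> {}"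
    using assms by auto
  have "(\<Sum>i<n. emeasure (return borel (\<omega> i)) B) = of_nat (card ({..<n} \<inter> \<omega> -` B))"
    using B by (simp add: indicator_def sum.If_cases vimage_def)
  then show "emeasure (empirical n \<omega>) B = emeasure (distr (measure_pmf (pmf_of_set {..<n})) borel \<omega>) B"
    using B ne assms
    by (simp add: emeasure_empirical emeasure_distr emeasure_pmf_of_set divide_ennreal
        ennreal_of_nat_eq_real_of_nat)
qed simp

lemma empirical_prob_algebra: "0 < n \<Longrightarrow> empirical n \<omega> \<in> space (prob_algebra borel)"
  by (simp add: space_prob_algebra empirical_eq_distr measure_pmf.prob_space_distr)

lemma distr_empirical:
  "0 < n \<Longrightarrow> \<theta> \<in> borel_measurable borel \<Longrightarrow> distr (empirical n \<omega>) borel \<theta> = empirical n (\<theta> \<circ> \<omega>)"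
  by (simp add: empirical_eq_distr distr_distr)

lemma integral_empirical:
  fixes f :: "'a::topological_space \<Rightarrow> real"
  assumes "0 < n" "f \<in> borel_measurable borel"
  shows "(\<integral>x. f x \<partial>empirical n \<omega>) = (\<Sum>i<n. f (\<omega> i)) / n"
proof -
  have "{..<n} \<noteq> {}"
    using assms by auto
  then show ?thesis
    using assms by (simp add: empirical_eq_distr integral_distr integral_pmf_of_set)
qed

lemma empirical_M1psi:
  assumes "0 < n" "\<psi> \<in> borel_measurable borel"
  shows "empirical n \<omega> \<in> M1psi \<psi>"
proof -
  have "{..<n} \<noteq> {}"
    using assms by auto
  then have "(\<integral>\<^sup>+x. ennreal (\<psi> x) \<partial>empirical n \<omega>) = (\<Sum>i<n. ennreal (\<psi> (\<omega> i))) / n"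
    using assms by (simp add: empirical_eq_distr nn_integral_distr nn_integral_pmf_of_set)
  also have "\<dots> < \<infinity>"
    using assms by (simp add: ennreal_divide_eq_top_iff less_top[symmetric])
  finally show ?thesis
    using assms by (simp add: M1psi_def empirical_prob_algebra)
qed

text \<open>Both measures are coupled through the same uniform index; the exceptional event of
  \<open>prohorov_distr_le\<close> then has probability 0.\<close>

lemma prohorov_empirical_le:
  fixes a b :: "nat \<Rightarrow> 'a::{metric_space, second_countable_topology}"
  assumes "0 < n" "0 < e" and lt: "\<And>i. i < n \<Longrightarrow> dist (a i) (b i) < e"
  shows "prohorov (empirical n a) (empirical n b) \<le> e"
proof -
  let ?p = "pmf_of_set {..<n}"
  have "{..<n} \<noteq> {}"
    using assms by auto
  then have "measure_pmf.prob ?p {i \<in> space (measure_pmf ?p). e \<le> dist (a i) (b i)} = 0"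
    using lt by (auto simp: measure_pmf_zero_iff) (meson lt not_le)
  with \<open>0 < e\<close> show ?thesis
    using \<open>0 < n\<close> by (auto simp: empirical_eq_distr intro!: measure_pmf.prohorov_distr_le)
qed

section \<open>Continuity in the sequence, as a source of measurability\<close>

text \<open>Only the first \<open>n\<close> coordinates matter: coordinatewise convergence is
  uniform on them, and the averages of \<open>\<psi>\<close> converge by continuity. The arbitrary
  filter lets the lemma serve for sequences and for both components of a pair of sequences.\<close>

lemma dpsi_empirical_tendsto_0:
  fixes X :: "'x \<Rightarrow> nat \<Rightarrow> 'a::{metric_space, second_countable_topology}"
  assumes n: "0 < n" and \<psi>: "continuous_on UNIV \<psi>"
    and X: "\<And>i. ((\<lambda>x. X x i) \<longlongrightarrow> a i) F"
  shows "((\<lambda>x. dpsi \<psi> (empirical n (X x)) (empirical n a)) \<longlongrightarrow> 0) F" (is ?L)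
    and "((\<lambda>x. dpsi \<psi> (empirical n a) (empirical n (X x))) \<longlongrightarrow> 0) F" (is ?R)
proof -
  have [measurable]: "\<psi> \<in> borel_measurable borel"
    using \<psi> by (rule borel_measurable_continuous_onI)
  have "isCont \<psi> x" for x
    using \<psi> by (simp add: continuous_on_eq_continuous_at)
  then have \<psi>_lim: "((\<lambda>x. (\<Sum>i<n. \<psi> (X x i)) / n) \<longlongrightarrow> (\<Sum>i<n. \<psi> (a i)) / n) F"
    using n by (intro tendsto_intros isCont_tendsto_compose[OF _ X]) auto
  have small: "\<forall>\<^sub>F x in F. \<forall>i\<in>{..<n}. dist (X x i) (a i) < e" if "0 < e" for e
    by (rule eventually_ball_finite) (use X that in \<open>auto simp: tendsto_iff\<close>)
  have "((\<lambda>x. prohorov (empirical n (X x)) (empirical n a)) \<longlongrightarrow> 0) F"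
  proof (rule tendstoI)
    fix e :: real assume e: "0 < e"
    then have "0 < e / 2"
      by simp
    from small[OF this] show "\<forall>\<^sub>F x in F. dist (prohorov (empirical n (X x)) (empirical n a)) 0 < e"
    proof eventually_elim
      case (elim x)
      then have "prohorov (empirical n (X x)) (empirical n a) \<le> e / 2"
        using n e by (intro prohorov_empirical_le) auto
      moreover have "0 \<le> prohorov (empirical n (X x)) (empirical n a)"
        using n by (intro prohorov_nonneg empirical_prob_algebra)
      ultimately show ?case
        using e by simp
    qed
  qed
  moreover have "((\<lambda>x. prohorov (empirical n a) (empirical n (X x))) \<longlongrightarrow> 0) F"
  proof (rule tendstoI)
    fix e :: real assume e: "0 < e"
    then have "0 < e / 2"
      by simp
    from small[OF this] show "\<forall>\<^sub>F x in F. dist (prohorov (empirical n a) (empirical n (X x))) 0 < e"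
    proof eventually_elim
      case (elim x)
      then have "prohorov (empirical n a) (empirical n (X x)) \<le> e / 2"
        using n e by (intro prohorov_empirical_le) (auto simp: dist_commute)
      moreover have "0 \<le> prohorov (empirical n a) (empirical n (X x))"
        using n by (intro prohorov_nonneg empirical_prob_algebra)
      ultimately show ?case
        using e by simp
    qed
  qed
  moreover have "((\<lambda>x. \<bar>(\<integral>y. \<psi> y \<partial>empirical n (X x)) - (\<integral>y. \<psi> y \<partial>empirical n a)\<bar>) \<longlongrightarrow> 0) F"
    using tendsto_diff[OF \<psi>_lim tendsto_const[of "(\<Sum>i<n. \<psi> (a i)) / n"]]
    by (intro tendsto_rabs_zero) (simp add: integral_empirical n)
  moreover have "((\<lambda>x. \<bar>(\<integral>y. \<psi> y \<partial>empirical n a) - (\<integral>y. \<psi> y \<partial>empirical n (X x))\<bar>) \<longlongrightarrow> 0) F"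
    using tendsto_diff[OF tendsto_const[of "(\<Sum>i<n. \<psi> (a i)) / n"] \<psi>_lim]
    by (intro tendsto_rabs_zero) (simp add: integral_empirical n)
  ultimately show ?L ?R
    unfolding dpsi_def by (auto intro!: tendsto_add_zero)
qed

text \<open>Since \<open>\<theta>\<close> is merely measurable, continuity is proved jointly in two
  sequences; inserting \<open>\<omega>\<close> and \<open>\<theta> \<circ> \<omega>\<close> then
  gives a measurable function.\<close>

lemma continuous_on_dpsi_empirical:
  fixes \<psi> :: "'a::{metric_space, second_countable_topology} \<Rightarrow> real"
  assumes n: "0 < n" and \<psi>: "continuous_on UNIV \<psi>"
  shows "continuous_on UNIV (\<lambda>z. dpsi \<psi> (empirical n (fst z)) (empirical n (snd z)))"
  unfolding continuous_on_def
proof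
  fix a :: "(nat \<Rightarrow> 'a) \<times> (nat \<Rightarrow> 'a)"
  have "((\<lambda>z. fst z i) \<longlongrightarrow> fst a i) (at a within UNIV)"
      and "((\<lambda>z. snd z i) \<longlongrightarrow> snd a i) (at a within UNIV)" for i
    using continuous_on_product_then_coordinatewise[OF continuous_on_fst[OF continuous_on_id[of UNIV]], of i]
      continuous_on_product_then_coordinatewise[OF continuous_on_snd[OF continuous_on_id[of UNIV]], of i]
    unfolding continuous_on_def by blast+
  note lims = dpsi_empirical_tendsto_0[where X = fst, OF n \<psi> this(1)]
    dpsi_empirical_tendsto_0[where X = snd, OF n \<psi> this(2)]
  let ?d = "\<lambda>z. dpsi \<psi> (empirical n (fst z)) (empirical n (snd z))"
  have "((\<lambda>z. ?d z - ?d a) \<longlongrightarrow> 0) (at a within UNIV)"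
  proof (rule Lim_null_comparison)
    show "\<forall>\<^sub>F z in at a within UNIV. norm (?d z - ?d a) \<le>
        dpsi \<psi> (empirical n (fst z)) (empirical n (fst a)) + dpsi \<psi> (empirical n (fst a)) (empirical n (fst z)) +
        dpsi \<psi> (empirical n (snd z)) (empirical n (snd a)) + dpsi \<psi> (empirical n (snd a)) (empirical n (snd z))"
      unfolding real_norm_def by (intro always_eventually allI dpsi_diff_le empirical_prob_algebra n)
  qed (intro tendsto_add_zero lims)
  then show "(?d \<longlongrightarrow> ?d a) (at a within UNIV)"
    by (rule LIM_zero_cancel)
qed

text \<open>Source of the measurability of \<open>\<tau>\<close> along empirical measures: nearby
  sequences have empirical measures close in \<open>dpsi\<close>.\<close>

lemma continuous_on_functional_empirical:
  fixes \<psi> :: "'a::{metric_space, second_countable_topology} \<Rightarrow> real"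
  assumes n: "0 < n" and \<psi>: "continuous_on UNIV \<psi>" and \<tau>: "uniformly_psi_continuous \<psi> \<tau>"
  shows "continuous_on UNIV (\<lambda>\<omega>. \<tau> (empirical n \<omega>))"
  unfolding continuous_on_def
proof (intro ballI tendstoI)
  fix a :: "nat \<Rightarrow> 'a" and e :: real assume "0 < e"
  with \<tau> obtain d where "0 < d"
    and d: "\<And>\<mu> \<nu>. \<mu> \<in> M1psi \<psi> \<Longrightarrow> \<nu> \<in> M1psi \<psi> \<Longrightarrow> dpsi \<psi> \<mu> \<nu> < d \<Longrightarrow> dist (\<tau> \<mu>) (\<tau> \<nu>) < e"
    unfolding uniformly_psi_continuous_def by metis
  have "((\<lambda>\<omega>. \<omega> i) \<longlongrightarrow> a i) (at a within UNIV)" for i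
    using continuous_on_product_coordinates[of i, where 'b = 'a] by (auto simp: continuous_on_def)
  from dpsi_empirical_tendsto_0(1)[where X = "\<lambda>\<omega>. \<omega>", OF n \<psi> this]
  have "\<forall>\<^sub>F \<omega> in at a within UNIV. dpsi \<psi> (empirical n \<omega>) (empirical n a) < d"
    using \<open>0 < d\<close> by (rule order_tendstoD)
  then show "\<forall>\<^sub>F \<omega> in at a within UNIV. dist (\<tau> (empirical n \<omega>)) (\<tau> (empirical n a)) < e"
    by eventually_elim (intro d empirical_M1psi n borel_measurable_continuous_onI \<psi>)
qed

text \<open>By second countability the product sigma-algebra is the Borel algebra of the product
  topology, so continuous functions of the sequence are measurable.\<close>

lemma sets_seq_space:
  "sets (seq_space :: (nat \<Rightarrow> 'a::second_countable_topology) measure) = sets borel"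
  unfolding seq_space_def by (rule sets_PiM_equal_borel)

subsection \<open>The canonical random measure as limit of the empirical measures\<close>

text \<open>Disintegration. With \<open>N\<close> the restriction of \<open>P\<close> to
  \<open>G\<close>, the defining property of conditional expectation says that
  \<open>N \<bind> \<upsilon>\<close> and the image of \<open>N\<close> under \<open>X\<close> agree
  on Borel sets. Equal measures integrate every nonnegative \<open>f\<close> equally.\<close>

lemma nn_integral_regular_conditional_law:
  fixes X :: "'w \<Rightarrow> 'a::topological_space"
  assumes P: "prob_space P" and F: "subalgebra P F" and X [measurable]: "X \<in> P \<rightarrow>\<^sub>M borel"
    and law: "regular_conditional_law P F X \<upsilon>"
    and G: "G \<in> sets F" and f [measurable]: "f \<in> borel_measurable borel"
  shows "(\<integral>\<^sup>+\<omega>. indicator G \<omega> * (\<integral>\<^sup>+x. f x \<partial>\<upsilon> \<omega>) \<partial>P) = (\<integral>\<^sup>+\<omega>. indicator G \<omega> * f (X \<omega>) \<partial>P)"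
proof -
  interpret prob_space P by (rule P)
  interpret finite_measure_subalgebra P F
    by standard (rule F)
  have GP [measurable]: "G \<in> sets P"
    using F G by (auto simp: subalgebra_def)
  have "\<upsilon> \<in> F \<rightarrow>\<^sub>M prob_algebra borel"
    using law by (simp add: regular_conditional_law_def)
  then have \<upsilon>: "\<upsilon> \<in> P \<rightarrow>\<^sub>M prob_algebra borel"
    by (rule measurable_from_subalg[OF F])
  then have \<upsilon>_sub [measurable]: "\<upsilon> \<in> P \<rightarrow>\<^sub>M subprob_algebra borel"
    by (rule measurable_prob_algebraD)
  have \<upsilon>_prob: "prob_space (\<upsilon> \<omega>)" "sets (\<upsilon> \<omega>) = sets borel" if "\<omega> \<in> space P" for \<omega>
    using measurable_space[OF \<upsilon> that] by (auto simp: space_prob_algebra)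
  define N where "N = density P (indicator G)"
  have [measurable_cong]: "sets N = sets P"
    by (simp add: N_def)
  have N: "(\<integral>\<^sup>+\<omega>. h \<omega> \<partial>N) = (\<integral>\<^sup>+\<omega>. indicator G \<omega> * h \<omega> \<partial>P)" if "h \<in> borel_measurable P" for h
    unfolding N_def by (rule nn_integral_density) (use that in measurable)
  have space_N: "space N \<noteq> {}"
    by (simp add: N_def not_empty)
  have "N \<bind> \<upsilon> = distr N borel X"
  proof (rule measure_eqI)
    show "sets (N \<bind> \<upsilon>) = sets (distr N borel X)"
      using \<upsilon>_prob by (subst sets_bind[where N = borel]) (auto simp: N_def not_empty)
    fix B assume "B \<in> sets (N \<bind> \<upsilon>)"
    also have "sets (N \<bind> \<upsilon>) = sets borel"
      using \<upsilon>_prob by (subst sets_bind[where N = borel]) (auto simp: N_def not_empty)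
    finally have [measurable]: "B \<in> sets borel" .
    let ?I = "indicator (X -` B \<inter> space P) :: 'w \<Rightarrow> real"
    have int: "integrable P ?I"
      by (intro integrable_real_indicator) (auto simp: less_top[symmetric] emeasure_eq_measure)
    have AE: "AE \<omega> in P. measure (\<upsilon> \<omega>) B = real_cond_exp P F ?I \<omega>"
      using law \<open>B \<in> sets borel\<close> by (simp add: regular_conditional_law_def)
    have [measurable]: "(\<lambda>\<omega>. measure (\<upsilon> \<omega>) B) \<in> borel_measurable P"
      by (rule measurable_compose[OF \<upsilon>_sub measurable_measure_subprob_algebra]) simp
    have "emeasure (N \<bind> \<upsilon>) B = (\<integral>\<^sup>+\<omega>. emeasure (\<upsilon> \<omega>) B \<partial>N)"
      by (rule emeasure_bind[OF space_N]) measurable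
    also have "\<dots> = (\<integral>\<^sup>+\<omega>. indicator G \<omega> * emeasure (\<upsilon> \<omega>) B \<partial>P)"
      by (rule N) measurable
    also have "\<dots> = (\<integral>\<^sup>+\<omega>. ennreal (indicator G \<omega> * measure (\<upsilon> \<omega>) B) \<partial>P)"
    proof (rule nn_integral_cong)
      fix \<omega> assume "\<omega> \<in> space P"
      then interpret \<upsilon>: prob_space "\<upsilon> \<omega>"
        by (rule \<upsilon>_prob)
      show "indicator G \<omega> * emeasure (\<upsilon> \<omega>) B = ennreal (indicator G \<omega> * measure (\<upsilon> \<omega>) B)"
        by (simp add: \<upsilon>.emeasure_eq_measure indicator_def)
    qed
    also have "\<dots> = ennreal (\<integral>\<omega>. indicator G \<omega> * measure (\<upsilon> \<omega>) B \<partial>P)"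
    proof (rule nn_integral_eq_integral)
      show "integrable P (\<lambda>\<omega>. indicator G \<omega> * measure (\<upsilon> \<omega>) B)"
      proof (rule integrable_const_bound[where B = 1])
        show "AE \<omega> in P. norm (indicator G \<omega> * measure (\<upsilon> \<omega>) B) \<le> 1"
          using prob_space.prob_le_1[OF \<upsilon>_prob(1)] by (intro AE_I2) (auto simp: indicator_def)
      qed measurable
    qed simp
    also have "(\<integral>\<omega>. indicator G \<omega> * measure (\<upsilon> \<omega>) B \<partial>P) = (\<integral>\<omega>. indicator G \<omega> * real_cond_exp P F ?I \<omega> \<partial>P)"
      using AE by (intro integral_cong_AE) auto
    \<comment> \<open>Here \<open>G\<close> belongs to \<open>F\<close>, so the conditional
      expectation may be replaced by the indicator itself.\<close>
    also have "\<dots> = (\<integral>\<omega>. indicator G \<omega> * ?I \<omega> \<partial>P)"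
      using real_cond_exp_intA[OF int G] by (simp add: set_lebesgue_integral_def)
    also have "ennreal \<dots> = (\<integral>\<^sup>+\<omega>. ennreal (indicator G \<omega> * ?I \<omega>) \<partial>P)"
      using integrable_mult_indicator[OF GP int] by (intro nn_integral_eq_integral[symmetric]) auto
    also have "\<dots> = (\<integral>\<^sup>+\<omega>. indicator G \<omega> * indicator (X -` B \<inter> space P) \<omega> \<partial>P)"
      by (intro nn_integral_cong) (simp add: indicator_def)
    also have "\<dots> = (\<integral>\<^sup>+\<omega>. indicator (X -` B \<inter> space P) \<omega> \<partial>N)"
      by (rule N[symmetric]) measurable
    also have "\<dots> = emeasure (distr N borel X) B"
      by (simp add: emeasure_distr N_def)
    finally show "emeasure (N \<bind> \<upsilon>) B = emeasure (distr N borel X) B" .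
  qed
  then have "(\<integral>\<^sup>+x. f x \<partial>(N \<bind> \<upsilon>)) = (\<integral>\<^sup>+x. f x \<partial>distr N borel X)"
    by simp
  also have "(\<integral>\<^sup>+x. f x \<partial>(N \<bind> \<upsilon>)) = (\<integral>\<^sup>+\<omega>. \<integral>\<^sup>+x. f x \<partial>\<upsilon> \<omega> \<partial>N)"
    by (rule nn_integral_bind[where B = borel]) measurable
  also have "\<dots> = (\<integral>\<^sup>+\<omega>. indicator G \<omega> * (\<integral>\<^sup>+x. f x \<partial>\<upsilon> \<omega>) \<partial>P)"
    by (rule N) measurable
  also have "(\<integral>\<^sup>+x. f x \<partial>distr N borel X) = (\<integral>\<^sup>+\<omega>. indicator G \<omega> * f (X \<omega>) \<partial>P)"
    by (simp add: nn_integral_distr N)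
  finally show ?thesis .
qed

section \<open>The shift and its invariant sets\<close>

lemma funpow_seq_shift: "(seq_shift ^^ i) \<omega> j = \<omega> (i + j)"
  by (induction i arbitrary: j) (simp_all add: seq_shift_def)

lemma seq_shift_measurable: "seq_shift \<in> seq_space \<rightarrow>\<^sub>M seq_space"
  unfolding seq_space_def seq_shift_def
  by (rule measurable_PiM_single') (auto simp: space_PiM)

lemma nth_measurable_seq_space: "(\<lambda>\<omega>. \<omega> i) \<in> seq_space \<rightarrow>\<^sub>M borel"
  unfolding seq_space_def by measurable

text \<open>Stationarity of the completion descends to \<open>Q\<close>, because image measures on
  \<open>seq_space\<close> are the same for both. On \<open>Q\<close> the shift is measurable from
  the space to itself.\<close>

lemma measure_preserving_seq_shift:
  fixes Q :: "(nat \<Rightarrow> 'a::topological_space) measure"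
  assumes Q: "prob_space Q" "sets Q = sets seq_space" and stat: "stationary (completion Q)"
  shows "measure_preserving Q seq_shift"
proof -
  interpret prob_space Q by (rule Q)
  have shift: "seq_shift \<in> Q \<rightarrow>\<^sub>M seq_space" and id: "(\<lambda>\<omega>. \<omega>) \<in> Q \<rightarrow>\<^sub>M seq_space"
    using seq_shift_measurable measurable_ident_sets[OF Q(2)] by (simp_all cong: measurable_cong_sets add: Q(2))
  have "distr Q Q seq_shift = distr Q seq_space seq_shift"
    by (rule distr_cong) (simp_all add: Q)
  also have "\<dots> = distr Q seq_space (\<lambda>\<omega>. \<omega>)"
    using stat by (simp add: stationary_def distr_completion shift id)
  also have "\<dots> = Q"
    by (rule distr_id2[OF Q(2)[symmetric]])
  finally show ?thesis
    using shift by unfold_locales (simp_all cong: measurable_cong_sets add: Q(2))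
qed

lemma space_invariant_algebra [simp]: "space invariant_algebra = UNIV"
  by (simp add: invariant_algebra_def space_measure_of_conv)

lemma subalgebra_invariant_algebra:
  assumes "sets Q = sets seq_space"
  shows "subalgebra Q invariant_algebra"
  using sets_eq_imp_space_eq[OF assms] assms
  by (auto simp: subalgebra_def sets_invariant_algebra)

text \<open>The level set of \<open>g\<close> through \<open>\<omega>\<close> is strictly invariant,
  so the identity holds at every point and not just almost surely.\<close>

lemma invariant_measurable_seq_shift:
  fixes g :: "(nat \<Rightarrow> 'a::topological_space) \<Rightarrow> real"
  assumes "g \<in> borel_measurable invariant_algebra"
  shows "g (seq_shift \<omega>) = g \<omega>"
proof -
  have "g -` {g \<omega>} \<inter> space invariant_algebra \<in> sets (invariant_algebra :: (nat \<Rightarrow> 'a) measure)"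
    using assms by (rule measurable_sets) simp
  then have "seq_shift -` (g -` {g \<omega>}) = g -` {g \<omega>}"
    by (simp add: sets_invariant_algebra)
  then show ?thesis
    by blast
qed

section \<open>Almost sure convergence of averages and of empirical measures\<close>

text \<open>The ergodic theorem for \<open>\<phi>\<close> of the first coordinate; by disintegration
  the integral of \<open>\<phi>\<close> against \<open>\<upsilon>\<close> is the required
  conditional expectation.\<close>

lemma AE_average_tendsto:
  fixes Q :: "(nat \<Rightarrow> 'a::topological_space) measure" and \<phi> :: "'a \<Rightarrow> real"
  assumes Q: "prob_space Q" "sets Q = sets seq_space" and stat: "stationary (completion Q)"
    and law: "regular_conditional_law (completion Q) invariant_algebra (\<lambda>\<omega>. \<omega> 0) \<upsilon>"
    and \<phi> [measurable]: "\<phi> \<in> borel_measurable borel" and nonneg: "\<And>x. 0 \<le> \<phi> x"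
    and fin: "(\<integral>\<^sup>+\<omega>. ennreal (\<phi> (\<omega> 0)) \<partial>completion Q) < \<infinity>"
  shows "AE \<omega> in completion Q. (\<lambda>n. (\<Sum>i<n. \<phi> (\<omega> i)) / n) \<longlonglongrightarrow> (\<integral>x. \<phi> x \<partial>\<upsilon> \<omega>)"
proof -
  let ?I = "invariant_algebra :: (nat \<Rightarrow> 'a) measure"
  interpret measure_preserving Q seq_shift
    by (rule measure_preserving_seq_shift[OF Q stat])
  have sub: "subalgebra Q ?I"
    by (rule subalgebra_invariant_algebra[OF Q(2)])
  then have sub': "subalgebra (completion Q) ?I"
    by (auto simp: subalgebra_def)
  have prob: "prob_space (completion Q)"
    by (rule prob_space.prob_space_completion) unfold_locales
  have space_Q: "space Q = UNIV"
    using sets_eq_imp_space_eq[OF Q(2)] by simp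
  have nth_Q [measurable]: "(\<lambda>\<omega>. \<omega> i) \<in> Q \<rightarrow>\<^sub>M borel" for i
    using nth_measurable_seq_space by (simp cong: measurable_cong_sets add: Q(2))
  have \<upsilon>: "\<upsilon> \<in> ?I \<rightarrow>\<^sub>M prob_algebra borel"
    using law by (simp add: regular_conditional_law_def)
  have sets_\<upsilon>: "sets (\<upsilon> \<omega>) = sets borel" for \<omega>
    using measurable_space[OF \<upsilon>, of \<omega>]
    by (auto simp: space_prob_algebra)
  \<comment> \<open>Extended values make \<open>k\<close> measurable for the invariant algebra at
    once; it is finite only almost surely.\<close>
  define k where "k \<omega> = (\<integral>\<^sup>+x. ennreal (\<phi> x) \<partial>\<upsilon> \<omega>)" for \<omega>
  have k_I: "k \<in> borel_measurable ?I"
    unfolding k_def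
    by (rule measurable_compose[OF measurable_prob_algebraD[OF \<upsilon>] nn_integral_measurable_subprob_algebra]) measurable
  then have k_Q [measurable]: "k \<in> borel_measurable Q"
    by (rule measurable_from_subalg[OF sub])
  have k_eq: "(\<integral>\<^sup>+\<omega>. indicator A \<omega> * k \<omega> \<partial>Q) = (\<integral>\<^sup>+\<omega>. indicator A \<omega> * ennreal (\<phi> (\<omega> 0)) \<partial>Q)"
    if "A \<in> sets ?I" for A
    using nn_integral_regular_conditional_law[OF prob sub' _ law that, of "\<lambda>x. ennreal (\<phi> x)"]
      measurable_completion[OF nth_Q[of 0]]
    by (simp add: k_def nn_integral_completion)
  have fin_Q: "(\<integral>\<^sup>+\<omega>. ennreal (\<phi> (\<omega> 0)) \<partial>Q) < \<infinity>"
    using fin by (simp add: nn_integral_completion)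
  have k_fin: "(\<integral>\<^sup>+\<omega>. k \<omega> \<partial>Q) < \<infinity>"
    using k_eq[of UNIV] fin_Q sets.top[of ?I] by simp
  then have AE_k: "AE \<omega> in Q. ennreal (enn2real (k \<omega>)) = k \<omega>"
    using nn_integral_PInf_AE[OF k_Q] by (auto simp: less_top)
  have f_int: "integrable Q (\<lambda>\<omega>. \<phi> (\<omega> 0))"
    using fin_Q nonneg by (intro integrableI_nonneg) auto
  have "(\<integral>\<^sup>+\<omega>. ennreal (enn2real (k \<omega>)) \<partial>Q) = (\<integral>\<^sup>+\<omega>. k \<omega> \<partial>Q)"
    using AE_k by (rule nn_integral_cong_AE)
  with k_fin have g_int: "integrable Q (\<lambda>\<omega>. enn2real (k \<omega>))"
    by (intro integrableI_nonneg) auto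
  have "AE \<omega> in Q. (\<lambda>n. (\<Sum>i<n. \<phi> ((seq_shift ^^ i) \<omega> 0)) / n) \<longlonglongrightarrow> enn2real (k \<omega>)"
  proof (rule pointwise_ergodic[OF f_int g_int])
    show "enn2real (k (seq_shift \<omega>)) = enn2real (k \<omega>)" for \<omega>
      by (rule invariant_measurable_seq_shift) (rule borel_measurable_enn2real[OF k_I])
    fix A assume A [measurable]: "A \<in> sets Q" and inv: "seq_shift -` A \<inter> space Q = A"
    then have AI: "A \<in> sets ?I"
      by (simp add: sets_invariant_algebra Q(2) space_Q)
    have "(\<integral>\<omega>. indicator A \<omega> * \<phi> (\<omega> 0) \<partial>Q) = enn2real (\<integral>\<^sup>+\<omega>. ennreal (indicator A \<omega> * \<phi> (\<omega> 0)) \<partial>Q)"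
      using nonneg by (intro integral_eq_nn_integral) auto
    also have "(\<integral>\<^sup>+\<omega>. ennreal (indicator A \<omega> * \<phi> (\<omega> 0)) \<partial>Q) = (\<integral>\<^sup>+\<omega>. indicator A \<omega> * ennreal (\<phi> (\<omega> 0)) \<partial>Q)"
      by (intro nn_integral_cong) (simp add: indicator_def)
    also have "\<dots> = (\<integral>\<^sup>+\<omega>. indicator A \<omega> * k \<omega> \<partial>Q)"
      by (rule k_eq[OF AI, symmetric])
    also have "\<dots> = (\<integral>\<^sup>+\<omega>. ennreal (indicator A \<omega> * enn2real (k \<omega>)) \<partial>Q)"
      using AE_k by (intro nn_integral_cong_AE) (auto simp: indicator_def)
    also have "enn2real \<dots> = (\<integral>\<omega>. indicator A \<omega> * enn2real (k \<omega>) \<partial>Q)"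
      by (intro integral_eq_nn_integral[symmetric]) auto
    finally show "(\<integral>\<omega>. indicator A \<omega> * \<phi> (\<omega> 0) \<partial>Q) = (\<integral>\<omega>. indicator A \<omega> * enn2real (k \<omega>) \<partial>Q)" .
  qed
  \<comment> \<open>This holds for every \<open>\<omega>\<close>: where \<open>k\<close> is
    infinite, both sides take the default value 0.\<close>
  moreover have "enn2real (k \<omega>) = (\<integral>x. \<phi> x \<partial>\<upsilon> \<omega>)" for \<omega>
    unfolding k_def using nonneg
    by (intro integral_eq_nn_integral[symmetric]) (auto cong: measurable_cong_sets simp: sets_\<upsilon>)
  ultimately show ?thesis
    by (simp add: funpow_seq_shift AE_completion)
qed

text \<open>Here \<open>\<eta>\<close> will be the identity or \<open>\<theta>\<close>. Averages of
  the indicators of all cells of all meshes, and of \<open>\<psi>\<close>, composed with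
  \<open>\<eta>\<close>, converge off one null set; \<open>prohorov_tendsto_0\<close> turns this
  into convergence of the measures.\<close>

lemma AE_dpsi_empirical_tendsto_0:
  fixes Q :: "(nat \<Rightarrow> 'a::{metric_space, second_countable_topology}) measure"
  assumes Q: "prob_space Q" "sets Q = sets seq_space" and stat: "stationary (completion Q)"
    and law: "regular_conditional_law (completion Q) invariant_algebra (\<lambda>\<omega>. \<omega> 0) \<upsilon>"
    and \<psi>: "\<psi> \<in> borel_measurable borel" "\<And>x. 0 \<le> \<psi> x"
    and \<eta> [measurable]: "(\<eta> :: 'a \<Rightarrow> 'a) \<in> borel \<rightarrow>\<^sub>M borel"
    and fin: "(\<integral>\<^sup>+\<omega>. ennreal (\<psi> (\<eta> (\<omega> 0))) \<partial>completion Q) < \<infinity>"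
  shows "AE \<omega> in completion Q.
    (\<lambda>n. dpsi \<psi> (empirical n (\<eta> \<circ> \<omega>)) (distr (\<upsilon> \<omega>) borel \<eta>)) \<longlonglongrightarrow> 0 \<and>
    (\<lambda>n. dpsi \<psi> (distr (\<upsilon> \<omega>) borel \<eta>) (empirical n (\<eta> \<circ> \<omega>))) \<longlonglongrightarrow> 0"
proof -
  note [measurable] = \<psi>(1)
  interpret prob_space "completion Q"
    using Q(1) by (rule prob_space.prob_space_completion)
  have "\<exists>A :: nat \<Rightarrow> 'a set. (\<forall>j. A j \<in> sets borel) \<and> disjoint_family A \<and> (\<Union>j. A j) = UNIV \<and>
      (\<forall>j x y. x \<in> A j \<longrightarrow> y \<in> A j \<longrightarrow> dist x y < inverse (real (Suc k)))" for k
    by (rule borel_partition_mesh[of "inverse (real (Suc k))", where 'a = 'a]) (simp, blast)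
  then have "\<exists>A :: nat \<Rightarrow> nat \<Rightarrow> 'a set. \<forall>k. (\<forall>j. A k j \<in> sets borel) \<and> disjoint_family (A k) \<and>
      (\<Union>j. A k j) = UNIV \<and> (\<forall>j x y. x \<in> A k j \<longrightarrow> y \<in> A k j \<longrightarrow> dist x y < inverse (real (Suc k)))"
    by (intro choice allI)
  then obtain A :: "nat \<Rightarrow> nat \<Rightarrow> 'a set" where A [measurable]: "\<And>k j. A k j \<in> sets borel"
    and A_part: "\<And>k. disjoint_family (A k)" "\<And>k. (\<Union>j. A k j) = UNIV"
    and mesh: "\<And>k j x y. x \<in> A k j \<Longrightarrow> y \<in> A k j \<Longrightarrow> dist x y < inverse (real (Suc k))"
    by blast
  have \<upsilon>: "\<upsilon> \<in> invariant_algebra \<rightarrow>\<^sub>M prob_algebra borel"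
    using law by (simp add: regular_conditional_law_def)
  have sets_\<upsilon> [measurable_cong, simp]: "sets (\<upsilon> \<omega>) = sets borel" and prob_\<upsilon>: "prob_space (\<upsilon> \<omega>)" for \<omega>
    using measurable_space[OF \<upsilon>, of \<omega>] by (auto simp: space_prob_algebra)
  have \<eta>_\<upsilon> [measurable]: "\<eta> \<in> \<upsilon> \<omega> \<rightarrow>\<^sub>M borel" for \<omega>
    by measurable
  have "(\<integral>\<^sup>+\<omega>. ennreal (indicator (A k j) (\<eta> (\<omega> 0))) \<partial>completion Q) \<le> (\<integral>\<^sup>+\<omega>. 1 \<partial>completion Q)" for k j
    by (rule nn_integral_mono) (simp add: indicator_def)
  then have "(\<integral>\<^sup>+\<omega>. ennreal (indicator (A k j) (\<eta> (\<omega> 0))) \<partial>completion Q) < \<infinity>" for k j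
    by (rule le_less_trans) (simp only: nn_integral_const emeasure_space_1, simp)
  then have "AE \<omega> in completion Q.
      (\<lambda>n. (\<Sum>i<n. indicator (A k j) (\<eta> (\<omega> i)) :: real) / n) \<longlonglongrightarrow> (\<integral>x. indicator (A k j) (\<eta> x) \<partial>\<upsilon> \<omega>)" for k j
    by (intro AE_average_tendsto[OF Q stat law, where \<phi> = "\<lambda>x. indicator (A k j) (\<eta> x)"]) simp_all
  then have "AE \<omega> in completion Q. \<forall>k j.
      (\<lambda>n. (\<Sum>i<n. indicator (A k j) (\<eta> (\<omega> i)) :: real) / n) \<longlonglongrightarrow> (\<integral>x. indicator (A k j) (\<eta> x) \<partial>\<upsilon> \<omega>)"
    by (simp add: AE_all_countable)
  moreover have "AE \<omega> in completion Q. (\<lambda>n. (\<Sum>i<n. \<psi> (\<eta> (\<omega> i))) / n) \<longlonglongrightarrow> (\<integral>x. \<psi> (\<eta> x) \<partial>\<upsilon> \<omega>)"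
    by (rule AE_average_tendsto[OF Q stat law, where \<phi> = "\<lambda>x. \<psi> (\<eta> x)"]) (simp_all add: \<psi>(2) fin[simplified])
  ultimately show ?thesis
  proof eventually_elim
    case (elim \<omega>)
    let ?\<nu> = "distr (\<upsilon> \<omega>) borel \<eta>" and ?\<mu> = "\<lambda>n. empirical n (\<eta> \<circ> \<omega>)"
    have \<nu>: "?\<nu> \<in> space (prob_algebra borel)"
      by (simp add: space_prob_algebra prob_space.prob_space_distr[OF prob_\<upsilon> \<eta>_\<upsilon>])
    \<comment> \<open>Only eventually, since \<open>empirical 0\<close> is not a probability
      measure.\<close>
    have \<mu>: "\<forall>\<^sub>F n in sequentially. ?\<mu> n \<in> space (prob_algebra borel)"
      using eventually_gt_at_top[of 0] by eventually_elim (rule empirical_prob_algebra)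
    have int_lim: "(\<lambda>n. \<integral>x. f x \<partial>?\<mu> n) \<longlonglongrightarrow> (\<integral>x. f x \<partial>?\<nu>)"
      if [measurable]: "f \<in> borel_measurable borel"
        and lim: "(\<lambda>n. (\<Sum>i<n. f (\<eta> (\<omega> i))) / n) \<longlonglongrightarrow> (\<integral>x. f (\<eta> x) \<partial>\<upsilon> \<omega>)" for f :: "'a \<Rightarrow> real"
    proof -
      have "\<forall>\<^sub>F n in sequentially. (\<Sum>i<n. f (\<eta> (\<omega> i))) / n = (\<integral>x. f x \<partial>?\<mu> n)"
        using eventually_gt_at_top[of 0] by eventually_elim (simp add: integral_empirical)
      with lim show ?thesis
        by (auto simp: integral_distr intro: Lim_transform_eventually)
    qed
    have space_\<mu>: "space (?\<mu> n) = UNIV" for n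
      using sets_eq_imp_space_eq[OF sets_empirical] by simp
    have "(\<lambda>n. measure (?\<mu> n) (A k j)) \<longlonglongrightarrow> measure ?\<nu> (A k j)" for k j
      using int_lim[of "indicator (A k j)"] elim(1) by (simp add: space_\<mu>)
    note \<pi> = prohorov_tendsto_0[OF \<mu> \<nu> A A_part mesh this]
    have \<psi>_lim: "(\<lambda>n. \<integral>x. \<psi> x \<partial>?\<mu> n) \<longlonglongrightarrow> (\<integral>x. \<psi> x \<partial>?\<nu>)"
      using elim(2) by (intro int_lim) auto
    have "(\<lambda>n. \<bar>(\<integral>x. \<psi> x \<partial>?\<mu> n) - (\<integral>x. \<psi> x \<partial>?\<nu>)\<bar>) \<longlonglongrightarrow> 0"
        "(\<lambda>n. \<bar>(\<integral>x. \<psi> x \<partial>?\<nu>) - (\<integral>x. \<psi> x \<partial>?\<mu> n)\<bar>) \<longlonglongrightarrow> 0"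
      using tendsto_diff[OF \<psi>_lim tendsto_const[of "\<integral>x. \<psi> x \<partial>?\<nu>"]]
        tendsto_diff[OF tendsto_const[of "\<integral>x. \<psi> x \<partial>?\<nu>"] \<psi>_lim]
      by (intro tendsto_rabs_zero; simp)+
    with \<pi> show ?case
      unfolding dpsi_def by (auto intro!: tendsto_add_zero)
  qed
qed

text \<open>The previous lemma for the identity and for \<open>\<theta>\<close>, combined through
  \<open>dpsi_diff_le\<close>.\<close>

lemma AE_dpsi_empirical_tendsto:
  fixes Q :: "(nat \<Rightarrow> 'a::{metric_space, second_countable_topology}) measure"
  assumes Q: "prob_space Q" "sets Q = sets seq_space" and stat: "stationary (completion Q)"
    and law: "regular_conditional_law (completion Q) invariant_algebra (\<lambda>\<omega>. \<omega> 0) \<upsilon>"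
    and \<psi>: "\<psi> \<in> borel_measurable borel" "\<And>x. 0 \<le> \<psi> x"
    and \<theta>: "\<theta> \<in> borel \<rightarrow>\<^sub>M borel"
    and fin: "(\<integral>\<^sup>+\<omega>. ennreal (\<psi> (\<omega> 0)) \<partial>completion Q) < \<infinity>"
      "(\<integral>\<^sup>+\<omega>. ennreal (\<psi> (\<theta> (\<omega> 0))) \<partial>completion Q) < \<infinity>"
  shows "AE \<omega> in completion Q. (\<lambda>n. dpsi \<psi> (empirical n \<omega>) (empirical n (\<theta> \<circ> \<omega>)))
    \<longlonglongrightarrow> dpsi \<psi> (\<upsilon> \<omega>) (distr (\<upsilon> \<omega>) borel \<theta>)"
proof -
  have \<upsilon>: "\<upsilon> \<in> invariant_algebra \<rightarrow>\<^sub>M prob_algebra borel"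
    using law by (simp add: regular_conditional_law_def)
  have \<upsilon>_prob: "\<upsilon> \<omega> \<in> space (prob_algebra borel)" for \<omega>
    using measurable_space[OF \<upsilon>, of \<omega>] by simp
  then have sets_\<upsilon>: "sets (\<upsilon> \<omega>) = sets borel" for \<omega>
    by (simp add: space_prob_algebra)
  have \<upsilon>\<theta>_prob: "distr (\<upsilon> \<omega>) borel \<theta> \<in> space (prob_algebra borel)" for \<omega>
    using \<upsilon>_prob[of \<omega>] \<theta>
    by (auto simp: space_prob_algebra cong: measurable_cong_sets intro!: prob_space.prob_space_distr)
  have "distr (\<upsilon> \<omega>) borel id = \<upsilon> \<omega>" for \<omega>
    using distr_id2[OF sets_\<upsilon>[symmetric], of \<omega>] by (simp add: id_def)
  with AE_dpsi_empirical_tendsto_0[OF Q stat law \<psi>, of id]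
  have "AE \<omega> in completion Q. (\<lambda>n. dpsi \<psi> (empirical n \<omega>) (\<upsilon> \<omega>)) \<longlonglongrightarrow> 0 \<and>
      (\<lambda>n. dpsi \<psi> (\<upsilon> \<omega>) (empirical n \<omega>)) \<longlonglongrightarrow> 0"
    using fin(1) by simp
  with AE_dpsi_empirical_tendsto_0[OF Q stat law \<psi> \<theta> fin(2)] show ?thesis
  proof eventually_elim
    case (elim \<omega>)
    let ?d = "\<lambda>n. dpsi \<psi> (empirical n \<omega>) (empirical n (\<theta> \<circ> \<omega>))"
      and ?D = "dpsi \<psi> (\<upsilon> \<omega>) (distr (\<upsilon> \<omega>) borel \<theta>)"
    have "(\<lambda>n. ?d n - ?D) \<longlonglongrightarrow> 0"
    proof (rule Lim_null_comparison)
      show "\<forall>\<^sub>F n in sequentially. norm (?d n - ?D) \<le>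
          dpsi \<psi> (empirical n \<omega>) (\<upsilon> \<omega>) + dpsi \<psi> (\<upsilon> \<omega>) (empirical n \<omega>) +
          dpsi \<psi> (empirical n (\<theta> \<circ> \<omega>)) (distr (\<upsilon> \<omega>) borel \<theta>) +
          dpsi \<psi> (distr (\<upsilon> \<omega>) borel \<theta>) (empirical n (\<theta> \<circ> \<omega>))"
        using eventually_gt_at_top[of 0] unfolding real_norm_def
        by eventually_elim (intro dpsi_diff_le empirical_prob_algebra \<upsilon>_prob \<upsilon>\<theta>_prob)
    qed (use elim in \<open>intro tendsto_add_zero; simp\<close>)
    then show ?case
      by (rule LIM_zero_cancel)
  qed
qed

section \<open>Measurability of the limit and convergence in probability\<close>

text \<open>\<open>g\<close> agrees almost everywhere with the measurable pointwise
  \<open>lim\<close>, so their preimages differ by null sets, which the completion absorbs.\<close>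

lemma borel_measurable_completion_AE_lim:
  fixes f :: "nat \<Rightarrow> 'a \<Rightarrow> real"
  assumes f: "\<And>n. f n \<in> borel_measurable M" and lim: "AE x in M. (\<lambda>n. f n x) \<longlonglongrightarrow> g x"
  shows "g \<in> borel_measurable (completion M)"
proof (rule measurableI)
  fix B :: "real set" assume B: "B \<in> sets borel"
  have "(\<lambda>x. lim (\<lambda>n. f n x)) \<in> borel_measurable (completion M)"
    using f by (intro measurable_completion borel_measurable_lim_metric)
  from measurable_sets[OF this B]
  have "(\<lambda>x. lim (\<lambda>n. f n x)) -` B \<inter> space M \<in> sets (completion M)"
    by simp
  moreover have "AE x in completion M. x \<in> (\<lambda>x. lim (\<lambda>n. f n x)) -` B \<inter> space M \<longleftrightarrow> x \<in> g -` B \<inter> space M"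
    using AE_completion[OF lim] by eventually_elim (simp add: limI)
  ultimately show "g -` B \<inter> space (completion M) \<in> sets (completion M)"
    using completion.in_sets_AE[of "(\<lambda>x. lim (\<lambda>n. f n x)) -` B \<inter> space M" "g -` B \<inter> space M" M] by simp
qed simp

text \<open>The strict gap between \<open>\<alpha>\<close> and \<open>\<beta>\<close> makes the
  events \<open>B n\<close>, where \<open>d n\<close> exceeds \<open>\<beta>\<close> but
  \<open>D\<close> does not exceed \<open>\<alpha>\<close>, fade out pointwise almost surely.
  Dominated convergence sends their probabilities to 0.\<close>

lemma (in prob_space) eventually_prob_gt_le:
  fixes D :: "'a \<Rightarrow> real"
  assumes d [measurable]: "\<And>n. d n \<in> borel_measurable M" and D [measurable]: "D \<in> borel_measurable M"
    and lim: "AE x in M. (\<lambda>n. d n x) \<longlonglongrightarrow> D x" and "\<alpha> < \<beta>" "0 < r"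
  shows "\<forall>\<^sub>F n in sequentially. prob {x \<in> space M. \<beta> < d n x} \<le> prob {x \<in> space M. \<alpha> < D x} + r"
proof -
  define B where "B n = {x \<in> space M. \<beta> < d n x \<and> D x \<le> \<alpha>}" for n
  have B [measurable]: "B n \<in> sets M" for n
    unfolding B_def by measurable
  have "(\<lambda>n. \<integral>x. indicator (B n) x \<partial>M) \<longlonglongrightarrow> (\<integral>x. 0 \<partial>M :: real)"
  proof (rule integral_dominated_convergence[where w = "\<lambda>_. 1"])
    show "AE x in M. (\<lambda>n. indicator (B n) x :: real) \<longlonglongrightarrow> 0"
      using lim
    proof (rule AE_mp, intro AE_I2 impI)
      fix x assume lim: "(\<lambda>n. d n x) \<longlonglongrightarrow> D x"
      have "\<forall>\<^sub>F n in sequentially. indicator (B n) x = (0::real)"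
      proof (cases "D x \<le> \<alpha>")
        case True
        with \<open>\<alpha> < \<beta>\<close> have "D x < \<beta>"
          by simp
        with lim have "\<forall>\<^sub>F n in sequentially. d n x < \<beta>"
          by (rule order_tendstoD)
        then show ?thesis
          by eventually_elim (simp add: B_def)
      qed (simp add: B_def)
      then show "(\<lambda>n. indicator (B n) x :: real) \<longlonglongrightarrow> 0"
        by (rule tendsto_eventually)
    qed
    show "AE x in M. norm (indicator (B n) x :: real) \<le> 1" for n
      by simp
  qed simp_all
  then have "(\<lambda>n. prob (B n)) \<longlonglongrightarrow> 0"
    using B by (simp add: sets.Int_space_eq2)
  then have "\<forall>\<^sub>F n in sequentially. prob (B n) < r"
    using \<open>0 < r\<close> by (rule order_tendstoD)
  then show ?thesis
  proof eventually_elim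
    case (elim n)
    have "prob {x \<in> space M. \<beta> < d n x} \<le> prob ({x \<in> space M. \<alpha> < D x} \<union> B n)"
      by (rule finite_measure_mono) (auto simp: B_def)
    also have "\<dots> \<le> prob {x \<in> space M. \<alpha> < D x} + prob (B n)"
      by (rule measure_Un_le) measurable
    finally show ?case
      using elim by simp
  qed
qed

section \<open>The bound on the limit superior\<close>

text \<open>Some natural number \<open>k \<ge> 1\<close> is admissible in the infimum: the tails of
  the real-valued distance tend to 0, while \<open>\<kappa>\<close> at \<open>k\<close> is at least
  \<open>\<kappa> 1\<close>, which is positive by strict monotonicity.\<close>

lemma theta_norm_less_top:
  fixes P :: "'w measure"
  assumes P: "prob_space P" and \<kappa>: "strict_mono \<kappa>"
    and D: "(\<lambda>\<omega>. dpsi \<psi> (\<upsilon> \<omega>) (distr (\<upsilon> \<omega>) borel \<theta>)) \<in> borel_measurable P"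
  shows "theta_norm P \<kappa> \<psi> \<upsilon> \<theta> < \<top>"
proof -
  interpret prob_space P by (rule P)
  define D where "D \<omega> = dpsi \<psi> (\<upsilon> \<omega>) (distr (\<upsilon> \<omega>) borel \<theta>)" for \<omega>
  have [measurable]: "D \<in> borel_measurable P"
    using D by (simp add: D_def[abs_def])
  have "(\<lambda>k. emeasure P {\<omega> \<in> space P. real k < D \<omega>}) \<longlonglongrightarrow> emeasure P (\<Inter>k. {\<omega> \<in> space P. real k < D \<omega>})"
  proof (rule Lim_emeasure_decseq)
    show "decseq (\<lambda>k. {\<omega> \<in> space P. real k < D \<omega>})"
      by (force simp: decseq_def)
  qed (simp_all add: image_subset_iff)
  also have "(\<Inter>k. {\<omega> \<in> space P. real k < D \<omega>}) = {}"
  proof -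
    have "\<exists>k. \<not> real k < D \<omega>" for \<omega>
      using reals_Archimedean2[of "D \<omega>"] less_asym by blast
    then show ?thesis
      by blast
  qed
  finally have "(\<lambda>k. emeasure P {\<omega> \<in> space P. real k < D \<omega>}) \<longlonglongrightarrow> 0"
    by simp
  moreover have "0 < \<kappa> 1"
    by (rule le_less_trans[OF zero_le strict_monoD[OF \<kappa>, of 0 1]]) simp
  ultimately have "\<forall>\<^sub>F k in sequentially. emeasure P {\<omega> \<in> space P. real k < D \<omega>} < \<kappa> 1"
    by (rule order_tendstoD)
  then have "\<forall>\<^sub>F k in sequentially. emeasure P {\<omega> \<in> space P. real k < D \<omega>} < \<kappa> 1 \<and> 1 \<le> k"
    using eventually_ge_at_top[of 1] by (rule eventually_conj)
  then obtain k where k: "emeasure P {\<omega> \<in> space P. real k < D \<omega>} < \<kappa> 1" "1 \<le> k"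
    unfolding eventually_sequentially by blast
  have "\<kappa> 1 \<le> \<kappa> (ennreal (real k))"
    using k(2) by (intro monoD[OF strict_mono_mono[OF \<kappa>]]) (simp flip: ennreal_1)
  with k have "theta_norm P \<kappa> \<psi> \<upsilon> \<theta> \<le> ennreal (real k)"
    unfolding theta_norm_def D_def[symmetric] by (intro Inf_lower imageI) auto
  also have "\<dots> < \<top>"
    by simp
  finally show ?thesis .
qed

text \<open>Polish spaces are expressed by second countability in the type and complete
  metrizability of the topology, so that the given metrics may be incomplete. \<open>Q\<close> is
  the law on the product sigma-algebra and \<open>P\<close> its completion.\<close>

theorem theorem2:
  fixes \<psi> :: "'e::{metric_space, second_countable_topology} \<Rightarrow> real"
    and Q P :: "(nat \<Rightarrow> 'e) measure"
    and \<upsilon> :: "(nat \<Rightarrow> 'e) \<Rightarrow> 'e measure"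
    and \<theta> :: "'e \<Rightarrow> 'e"
    and \<tau> :: "'e measure \<Rightarrow> 't::{metric_space, second_countable_topology}"
    and \<kappa> :: "ennreal \<Rightarrow> ennreal"
  assumes "completely_metrizable_space (euclidean :: 'e topology)"
    and "completely_metrizable_space (euclidean :: 't topology)"
    and "continuous_on UNIV \<psi>" and "\<And>x. 1 \<le> \<psi> x"
    and "prob_space Q" and "sets Q = sets seq_space" and "P = completion Q"
    and "regular_conditional_law P invariant_algebra (\<lambda>\<omega>. \<omega> 0) \<upsilon>"
    and "\<theta> \<in> borel \<rightarrow>\<^sub>M borel"
    and "stationary P"
    and "distr P borel (\<lambda>\<omega>. \<omega> 0) \<in> M1psi \<psi>"
    and "distr P borel (\<lambda>\<omega>. \<theta> (\<omega> 0)) \<in> M1psi \<psi>"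
    and "uniformly_psi_continuous \<psi> \<tau>"
    and "modulus_of_continuity \<psi> \<tau> \<kappa>"
  shows "limsup (\<lambda>n. ennreal (prohorov
             (distr P borel (\<lambda>\<omega>. \<tau> (empirical n \<omega>)))
             (distr P borel (\<lambda>\<omega>. \<tau> (distr (empirical n \<omega>) borel \<theta>)))))
           \<le> \<kappa> (theta_norm P \<kappa> \<psi> \<upsilon> \<theta>)"
proof -
  note \<psi> = assms(3) and \<psi>_ge1 = assms(4) and Q = assms(5,6) and P_def = assms(7)
    and \<theta> [measurable] = assms(9) and \<tau> = assms(13)
  note law = assms(8)[unfolded P_def] and stat = assms(10)[unfolded P_def]
  have [measurable]: "\<psi> \<in> borel_measurable borel"
    using \<psi> by (rule borel_measurable_continuous_onI)
  have \<psi>_nonneg: "0 \<le> \<psi> x" for x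
    using \<psi>_ge1[of x] by simp
  have \<kappa>_cont: "continuous_on UNIV \<kappa>" and \<kappa>_strict: "strict_mono \<kappa>"
    and \<kappa>: "\<And>\<mu> \<nu>. \<mu> \<in> M1psi \<psi> \<Longrightarrow> \<nu> \<in> M1psi \<psi> \<Longrightarrow> ennreal (dist (\<tau> \<mu>) (\<tau> \<nu>)) \<le> \<kappa> (ennreal (dpsi \<psi> \<mu> \<nu>))"
    using assms(14) by (auto simp: modulus_of_continuity_def)
  note \<kappa>_mono = monoD[OF strict_mono_mono[OF \<kappa>_strict]]
  interpret P: prob_space P
    unfolding P_def using Q(1) by (rule prob_space.prob_space_completion)

  have id_Q [measurable]: "(\<lambda>\<omega>. \<omega>) \<in> Q \<rightarrow>\<^sub>M borel"
    by (rule measurable_ident_sets) (simp add: Q sets_seq_space)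
  have nth_Q: "(\<lambda>\<omega>. \<omega> i) \<in> Q \<rightarrow>\<^sub>M borel" for i
    using nth_measurable_seq_space by (simp cong: measurable_cong_sets add: Q)
  have \<theta>_Q [measurable]: "(\<lambda>\<omega>. \<theta> \<circ> \<omega>) \<in> Q \<rightarrow>\<^sub>M borel"
  proof -
    have "(\<lambda>\<omega> i. \<theta> (\<omega> i)) \<in> Q \<rightarrow>\<^sub>M (\<Pi>\<^sub>M i\<in>UNIV. borel)"
      using measurable_compose[OF nth_Q \<theta>] by (intro measurable_PiM_single') auto
    then show ?thesis
      by (simp add: o_def cong: measurable_cong_sets add: sets_PiM_equal_borel)
  qed
  have nth_P [measurable]: "(\<lambda>\<omega>. \<omega> i) \<in> P \<rightarrow>\<^sub>M borel" for i
    unfolding P_def using nth_Q by (rule measurable_completion)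
  have fin: "(\<integral>\<^sup>+\<omega>. ennreal (\<psi> (\<omega> 0)) \<partial>completion Q) < \<infinity>"
      "(\<integral>\<^sup>+\<omega>. ennreal (\<psi> (\<theta> (\<omega> 0))) \<partial>completion Q) < \<infinity>"
    using assms(11,12) unfolding P_def[symmetric] by (simp_all add: M1psi_def nn_integral_distr)

  define d where "d n \<omega> = dpsi \<psi> (empirical n \<omega>) (empirical n (\<theta> \<circ> \<omega>))" for n \<omega>
  define D where "D \<omega> = dpsi \<psi> (\<upsilon> \<omega>) (distr (\<upsilon> \<omega>) borel \<theta>)" for \<omega>
  \<comment> \<open>Everything is stated at \<open>Suc n\<close> to stay with nonempty samples;
    \<open>limsup_shift\<close> undoes the shift at the end.\<close>
  have d_Q: "d (Suc n) \<in> borel_measurable Q" for n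
    unfolding d_def
    by (rule borel_measurable_continuous_Pair[OF id_Q \<theta>_Q continuous_on_dpsi_empirical[OF _ \<psi>]]) simp
  have d_P: "d (Suc n) \<in> borel_measurable P" for n
    unfolding P_def by (rule measurable_completion[OF d_Q])
  have "AE \<omega> in P. (\<lambda>n. d n \<omega>) \<longlonglongrightarrow> D \<omega>"
    unfolding d_def D_def P_def
    by (rule AE_dpsi_empirical_tendsto[OF Q stat law _ _ \<theta> fin]) (simp_all add: \<psi>_nonneg)
  then have lim: "AE \<omega> in P. (\<lambda>n. d (Suc n) \<omega>) \<longlonglongrightarrow> D \<omega>"
    by eventually_elim (rule LIMSEQ_Suc)
  have D_P: "D \<in> borel_measurable P"
    using lim unfolding P_def AE_completion_iff by (rule borel_measurable_completion_AE_lim[OF d_Q])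

  define X where "X n \<omega> = \<tau> (empirical n \<omega>)" for n \<omega>
  define Y where "Y n \<omega> = \<tau> (empirical n (\<theta> \<circ> \<omega>))" for n \<omega>
  have X_P: "X (Suc n) \<in> borel_measurable P" and Y_P: "Y (Suc n) \<in> borel_measurable P" for n
  proof -
    \<comment> \<open>\<open>X\<close> and \<open>Y\<close> are one continuous function of a
      sequence, evaluated at \<open>\<omega>\<close> and at
      \<open>\<theta> \<circ> \<omega>\<close>.\<close>
    have "(\<lambda>\<omega>. \<tau> (empirical (Suc n) \<omega>)) \<in> borel_measurable borel"
      by (rule borel_measurable_continuous_onI[OF continuous_on_functional_empirical[OF _ \<psi> \<tau>]]) simp
    from measurable_compose[OF id_Q this] measurable_compose[OF \<theta>_Q this]
    show "X (Suc n) \<in> borel_measurable P" and "Y (Suc n) \<in> borel_measurable P"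
      unfolding X_def Y_def P_def by (auto intro: measurable_completion)
  qed
  define a where "a n = ennreal (prohorov (distr P borel (X n)) (distr P borel (Y n)))" for n

  have bound: "limsup (\<lambda>n. a (Suc n)) \<le> \<kappa> (ennreal \<beta>)"
    if norm_less: "theta_norm P \<kappa> \<psi> \<upsilon> \<theta> < ennreal \<beta>" for \<beta>
  \<comment> \<open>The rule leaves only the case of finite \<open>\<kappa>\<close> at
    \<open>\<beta>\<close>, whose value becomes the real number \<open>c\<close>.\<close>
  proof (rule ennreal_le_epsilon)
    fix r :: real assume "\<kappa> (ennreal \<beta>) < \<top>" and r: "0 < r"
    then obtain c where c: "0 \<le> c" "\<kappa> (ennreal \<beta>) = ennreal c"
      by (cases "\<kappa> (ennreal \<beta>)") auto
    \<comment> \<open>An infimum below \<open>\<beta>\<close> yields an admissible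
      \<open>\<alpha>\<close> strictly below \<open>\<beta>\<close>, leaving the gap that
      \<open>eventually_prob_gt_le\<close> requires.\<close>
    obtain \<alpha> where \<alpha>: "0 < \<alpha>" "\<alpha> < \<beta>" "emeasure P {\<omega> \<in> space P. D \<omega> > \<alpha>} \<le> \<kappa> (ennreal \<alpha>)"
      using norm_less unfolding theta_norm_def D_def[symmetric] Inf_less_iff
      by (auto simp: ennreal_less_iff)
    have "emeasure P {\<omega> \<in> space P. D \<omega> > \<alpha>} \<le> ennreal c"
      using \<alpha> \<kappa>_mono[of "ennreal \<alpha>" "ennreal \<beta>"] c by (auto intro: order_trans ennreal_leI)
    then have D_le: "P.prob {\<omega> \<in> space P. D \<omega> > \<alpha>} \<le> c"
      using c by (simp add: P.emeasure_eq_measure)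
    have "\<forall>\<^sub>F n in sequentially.
        P.prob {\<omega> \<in> space P. \<beta> < d (Suc n) \<omega>} \<le> P.prob {\<omega> \<in> space P. \<alpha> < D \<omega>} + r"
      by (rule P.eventually_prob_gt_le[OF d_P D_P lim \<alpha>(2) r])
    then have "\<forall>\<^sub>F n in sequentially. a (Suc n) \<le> \<kappa> (ennreal \<beta>) + ennreal r"
    proof eventually_elim
      case (elim n)
      note [measurable] = d_P[of n]
      \<comment> \<open>If the distance of the empirical measures is at most \<open>\<beta>\<close>,
        the modulus bounds that of the functionals by \<open>c\<close>. The slack \<open>r\<close>
        contradicts this strictly, and it also covers the excess probability below.\<close>
      have "{\<omega> \<in> space P. c + r \<le> dist (X (Suc n) \<omega>) (Y (Suc n) \<omega>)} \<subseteq> {\<omega> \<in> space P. \<beta> < d (Suc n) \<omega>}"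
      proof safe
        fix \<omega> assume ge: "c + r \<le> dist (X (Suc n) \<omega>) (Y (Suc n) \<omega>)"
        show "\<beta> < d (Suc n) \<omega>"
        proof (rule ccontr)
          assume "\<not> \<beta> < d (Suc n) \<omega>"
          then have "\<kappa> (ennreal (d (Suc n) \<omega>)) \<le> ennreal c"
            unfolding c(2)[symmetric] by (intro \<kappa>_mono ennreal_leI) simp
          moreover have "ennreal (dist (X (Suc n) \<omega>) (Y (Suc n) \<omega>)) \<le> \<kappa> (ennreal (d (Suc n) \<omega>))"
            unfolding X_def Y_def d_def by (intro \<kappa> empirical_M1psi) simp_all
          ultimately have "ennreal (dist (X (Suc n) \<omega>) (Y (Suc n) \<omega>)) \<le> ennreal c"
            by simp
          with ge c r show False
            by simp
        qed
      qed
      then have "P.prob {\<omega> \<in> space P. c + r \<le> dist (X (Suc n) \<omega>) (Y (Suc n) \<omega>)} \<le>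
          P.prob {\<omega> \<in> space P. \<beta> < d (Suc n) \<omega>}"
        by (rule P.finite_measure_mono) measurable
      also have "\<dots> \<le> c + r"
        using elim D_le by linarith
      finally have "P.prob {\<omega> \<in> space P. c + r \<le> dist (X (Suc n) \<omega>) (Y (Suc n) \<omega>)} \<le> c + r" .
      then have "prohorov (distr P borel (X (Suc n))) (distr P borel (Y (Suc n))) \<le> c + r"
        using c r by (intro P.prohorov_distr_le X_P Y_P) auto
      then show ?case
        using c r by (simp add: a_def ennreal_leI flip: ennreal_plus)
    qed
    then show "limsup (\<lambda>n. a (Suc n)) \<le> \<kappa> (ennreal \<beta>) + ennreal r"
      by (rule Limsup_bounded)
  qed

  \<comment> \<open>Finiteness of the norm allows approaching it by real \<open>\<beta>\<close>
    strictly above it; continuity of \<open>\<kappa>\<close> then carries the bound to the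
    limit.\<close>
  obtain t where t: "0 \<le> t" "theta_norm P \<kappa> \<psi> \<upsilon> \<theta> = ennreal t"
    using theta_norm_less_top[OF P.prob_space_axioms \<kappa>_strict D_P[unfolded D_def[abs_def]]]
    by (cases "theta_norm P \<kappa> \<psi> \<upsilon> \<theta>") auto
  have "(\<lambda>k. t + inverse (real (Suc k))) \<longlonglongrightarrow> t + 0"
    by (intro tendsto_intros LIMSEQ_inverse_real_of_nat)
  then have "(\<lambda>k. ennreal (t + inverse (real (Suc k)))) \<longlonglongrightarrow> ennreal t"
    by (intro tendsto_ennrealI) simp
  then have "(\<lambda>k. \<kappa> (ennreal (t + inverse (real (Suc k))))) \<longlonglongrightarrow> \<kappa> (ennreal t)"
    using \<kappa>_cont by (intro isCont_tendsto_compose[of _ \<kappa>]) (auto simp: continuous_on_eq_continuous_at)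
  moreover have "limsup (\<lambda>n. a (Suc n)) \<le> \<kappa> (ennreal (t + inverse (real (Suc k))))" for k
    using t by (intro bound) (simp add: ennreal_less_iff)
  ultimately have "limsup (\<lambda>n. a (Suc n)) \<le> \<kappa> (theta_norm P \<kappa> \<psi> \<upsilon> \<theta>)"
    unfolding t(2) by (intro LIMSEQ_le_const) auto
  \<comment> \<open>The two sequences agree for \<open>n > 0\<close>, where the image of an
    empirical measure is the empirical measure of the image sequence.\<close>
  moreover have "limsup (\<lambda>n. ennreal (prohorov
      (distr P borel (\<lambda>\<omega>. \<tau> (empirical n \<omega>)))
      (distr P borel (\<lambda>\<omega>. \<tau> (distr (empirical n \<omega>) borel \<theta>))))) = limsup a"
    unfolding a_def X_def Y_def
    by (intro Limsup_eq eventually_mono[OF eventually_gt_at_top[of 0]]) (simp add: distr_empirical[OF _ \<theta>])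
  ultimately show ?thesis
    using limsup_shift[of a] by simp
qed

end
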